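(* The conflict-free closed neighborhood (CF-CN) coloring problem and the conflict-free open neighborhood (CF-ON) coloring problem can each be solved in polynomial time on cographs: there are polynomial-time algorithms that, given a finite simple connected undirected cograph $G$ and an integer $k$, decide whether $G$ has a CF-CN coloring $V(G)\to\{1,\dots,k\}$ and, respectively, whether $G$ has a CF-ON coloring $V(G)\to\{1,\dots,k\}$.
   Context: A cograph is a graph with no induced path on four vertices ($P_4$-free graph). Let $N(v)$ be the set of vertices adjacent to $v$ and $N[v]=N(v)\cup\{v\}$. For a coloring $C_G:V(G)\to\{1,\dots,k\}$ (not necessarily proper), a set $U\subseteq V(G)$ has a unique color if there is a color $c$ with $|\{u\in U: C_G(u)=c\}|=1$. The coloring is a conflict-free closed neighborhood (CF-CN) coloring if $N[v]$ has a unique color for every $v\in V(G)$, and a conflict-free open neighborhood (CF-ON) coloring if $N(v)$ has a unique color for every $v\in V(G)$. *)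

theory Defs
  imports
    "Graph_Theory.Graph_Theory"
    "HOL-Computational_Algebra.Polynomial"
begin

section \<open>Deterministic multi-tape Turing machines\<close>

text \<open>
  States and tape symbols are natural numbers below the bounds stored in the machine. Tapes are
  one-way infinite and every cell is readable and writable. Of the tape symbols, 0 is the blank,
  1 marks the left end (it is written to cell 0 of every tape in the initial configuration), and
  2 and 3 stand for the input bits.
\<close>

datatype move = Move_Left | Stay | Move_Right

record tm =
  num_tapes :: nat
  num_symbols :: nat
  num_states :: nat
  start_state :: nat
  accept_state :: nat
  reject_state :: nat
  trans :: "nat \<Rightarrow> nat list \<Rightarrow> nat \<times> (nat \<times> move) list"

text \<open>
  Only finitely many arguments of \<^const>\<open>trans\<close> matter for a well-formed machine: its values
  elsewhere are never used in a run, so a well-formed machine is a finite object.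
\<close>

definition wf_tm :: "tm \<Rightarrow> bool" where
  "wf_tm M \<longleftrightarrow>
     1 \<le> num_tapes M \<and> 4 \<le> num_symbols M \<and>
     start_state M < num_states M \<and> accept_state M < num_states M \<and>
     reject_state M < num_states M \<and> accept_state M \<noteq> reject_state M \<and>
     (\<forall>q syms. q < num_states M \<longrightarrow> length syms = num_tapes M \<longrightarrow> set syms \<subseteq> {..<num_symbols M} \<longrightarrow>
        fst (trans M q syms) < num_states M \<and>
        length (snd (trans M q syms)) = num_tapes M \<and>
        (\<forall>a \<in> set (snd (trans M q syms)). fst a < num_symbols M))"

text \<open>A tape is its contents together with the position of the head.\<close>

type_synonym tape = "(nat \<Rightarrow> nat) \<times> nat"

type_synonym config = "nat \<times> tape list"

definition read_tape :: "tape \<Rightarrow> nat" where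
  "read_tape t = fst t (snd t)"

text \<open>A left move in cell 0 leaves the head where it is.\<close>

fun move_head :: "move \<Rightarrow> nat \<Rightarrow> nat" where
  "move_head Move_Left p = p - 1"
| "move_head Stay p = p"
| "move_head Move_Right p = p + 1"

definition act_on_tape :: "nat \<times> move \<Rightarrow> tape \<Rightarrow> tape" where
  "act_on_tape a t = ((fst t)(snd t := fst a), move_head (snd a) (snd t))"

definition halted :: "tm \<Rightarrow> config \<Rightarrow> bool" where
  "halted M c \<longleftrightarrow> fst c = accept_state M \<or> fst c = reject_state M"

definition tm_step :: "tm \<Rightarrow> config \<Rightarrow> config" where
  "tm_step M c =
     (if halted M c then c
      else let (q, acts) = trans M (fst c) (map read_tape (snd c))
           in (q, map2 act_on_tape acts (snd c)))"

definition bit_symbol :: "bool \<Rightarrow> nat" where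
  "bit_symbol b = (if b then 3 else 2)"

definition init_tape :: "bool list \<Rightarrow> tape" where
  "init_tape xs =
     ((\<lambda>i. if i = 0 then 1 else if i \<le> length xs then bit_symbol (xs ! (i - 1)) else 0), 0)"

definition init_config :: "tm \<Rightarrow> bool list \<Rightarrow> config" where
  "init_config M xs =
     (start_state M, init_tape xs # replicate (num_tapes M - 1) (init_tape []))"

definition accepts_within :: "tm \<Rightarrow> bool list \<Rightarrow> nat \<Rightarrow> bool" where
  "accepts_within M xs T \<longleftrightarrow>
     (\<exists>t \<le> T. fst ((tm_step M ^^ t) (init_config M xs)) = accept_state M)"

definition rejects_within :: "tm \<Rightarrow> bool list \<Rightarrow> nat \<Rightarrow> bool" where
  "rejects_within M xs T \<longleftrightarrow>
     (\<exists>t \<le> T. fst ((tm_step M ^^ t) (init_config M xs)) = reject_state M)"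

text \<open>
  The decision problem with instances \<open>I\<close>, encoded by \<open>enc\<close>, and question \<open>Q\<close>. This is a promise
  problem: nothing is required on words that do not encode an element of \<open>I\<close>.
\<close>

definition poly_time_solvable :: "'i set \<Rightarrow> ('i \<Rightarrow> bool list) \<Rightarrow> ('i \<Rightarrow> bool) \<Rightarrow> bool" where
  "poly_time_solvable I enc Q \<longleftrightarrow>
     (\<exists>M (p :: nat poly). wf_tm M \<and>
        (\<forall>x \<in> I.
           (Q x \<longrightarrow> accepts_within M (enc x) (poly p (length (enc x)))) \<and>
           (\<not> Q x \<longrightarrow> rejects_within M (enc x) (poly p (length (enc x))))))"


section \<open>Cographs and conflict-free colorings\<close>

text \<open>
  Finite simple undirected graphs are given by the locale predicate \<^const>\<open>pair_graph\<close>: an edge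
  between \<open>u\<close> and \<open>v\<close> is present as the two arcs \<open>(u, v)\<close> and \<open>(v, u)\<close>.
\<close>

definition P4_free :: "'a pair_pre_digraph \<Rightarrow> bool" where
  "P4_free G \<longleftrightarrow>
     \<not> (\<exists>a \<in> pverts G. \<exists>b \<in> pverts G. \<exists>c \<in> pverts G. \<exists>d \<in> pverts G. distinct [a, b, c, d] \<and>
          (a, b) \<in> parcs G \<and> (b, c) \<in> parcs G \<and> (c, d) \<in> parcs G \<and>
          (a, c) \<notin> parcs G \<and> (a, d) \<notin> parcs G \<and> (b, d) \<notin> parcs G)"

definition cograph :: "'a pair_pre_digraph \<Rightarrow> bool" where
  "cograph G \<longleftrightarrow> pair_graph G \<and> P4_free G"

definition open_nbhd :: "'a pair_pre_digraph \<Rightarrow> 'a \<Rightarrow> 'a set" where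
  "open_nbhd G v = {u \<in> pverts G. (v, u) \<in> parcs G}"

definition closed_nbhd :: "'a pair_pre_digraph \<Rightarrow> 'a \<Rightarrow> 'a set" where
  "closed_nbhd G v = insert v (open_nbhd G v)"

definition has_unique_color :: "('a \<Rightarrow> int) \<Rightarrow> 'a set \<Rightarrow> bool" where
  "has_unique_color C U \<longleftrightarrow> (\<exists>c. card {u \<in> U. C u = c} = 1)"

definition CF_CN_coloring :: "'a pair_pre_digraph \<Rightarrow> int \<Rightarrow> ('a \<Rightarrow> int) \<Rightarrow> bool" where
  "CF_CN_coloring G k C \<longleftrightarrow>
     C ` pverts G \<subseteq> {1..k} \<and> (\<forall>v \<in> pverts G. has_unique_color C (closed_nbhd G v))"

definition CF_ON_coloring :: "'a pair_pre_digraph \<Rightarrow> int \<Rightarrow> ('a \<Rightarrow> int) \<Rightarrow> bool" where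
  "CF_ON_coloring G k C \<longleftrightarrow>
     C ` pverts G \<subseteq> {1..k} \<and> (\<forall>v \<in> pverts G. has_unique_color C (open_nbhd G v))"


section \<open>Problem instances and their encoding\<close>

text \<open>As usual for graphs given to a machine, the vertices are numbered from 0.\<close>

definition cograph_instances :: "(nat pair_pre_digraph \<times> int) set" where
  "cograph_instances =
     {(G, k). cograph G \<and> connected G \<and> (\<exists>n. pverts G = {..<n})}"

text \<open>Binary representation, least significant bit first.\<close>

fun nat_bits :: "nat \<Rightarrow> bool list" where
  "nat_bits n = (if n = 0 then [] else odd n # nat_bits (n div 2))"

declare nat_bits.simps [simp del]

text \<open>
  The number \<open>n\<close> of vertices in unary, closed by a 0; the \<open>n \<times> n\<close> adjacency matrix row by row;
  the sign bit of \<open>k\<close>; the absolute value of \<open>k\<close> in binary.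
\<close>

fun encode_instance :: "nat pair_pre_digraph \<times> int \<Rightarrow> bool list" where
  "encode_instance (G, k) =
     (let n = card (pverts G)
      in replicate n True @ [False] @
         [(i, j) \<in> parcs G. i \<leftarrow> [0..<n], j \<leftarrow> [0..<n]] @
         [k < 0] @ nat_bits (nat \<bar>k\<bar>))"

end

theory Submission
  imports Defs
begin

text \<open>
  A connected cograph with at least two vertices is a join of two parts \<open>A\<close> and \<open>B\<close>. Giving one
  vertex of each part a private color shows that three colors always suffice once no neighborhood is
  empty, and one color works iff all neighborhoods are singletons. With two colors, a vertex of \<open>A\<close>
  sees all of \<open>B\<close>, so one of the colors occurs at most once in \<open>B\<close>, and likewise in \<open>A\<close>. Either one
  color class then has at most two vertices, or the colorings are so restricted that the red class
  can be taken to be \<open>{x, y}\<close> or \<open>N(x) - {y}\<close> for two vertices \<open>x\<close> and \<open>y\<close>.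

  Hence colorability is expressed by one fixed first-order formula over the adjacency matrix, the
  sign and the three lowest bits of \<open>k\<close>, and a Turing machine evaluates such a formula in polynomial time by
  looping over the quantified vertices, which it keeps in unary as head positions.
\<close>

section \<open>Two-colorings of joins\<close>

text \<open>A red class ranges over exponentially many sets; the obstacle is to replace it by
  boundedly many vertices. Small classes are no problem, so suppose that \<open>A\<close> is blue
  and \<open>B\<close> red up to one exception each, both colors being frequent. A vertex of
  \<open>A\<close> then sees two red vertices, so it must see exactly one blue vertex. If
  \<open>B\<close> is entirely red, this blue vertex lies in \<open>A\<close>, and a suitable
  neighborhood \<open>N x\<close> consists of the red class and one further vertex \<open>y\<close>.
  If each side has an exception, no vertex of a side sees the exception of its own side, so every
  vertex sees exactly one of the two exceptions, and these two alone form a valid red class, in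
  general different from the given one.

  Open and closed neighborhoods enter this argument only through the fact that
  \<open>v \<in> N v\<close> holds for all \<open>v\<close> or for none, so both problems are
  treated at once by a flag. The number \<open>k\<close> matters only through its comparison with 1,
  2 and 3, which is why a formula that does not depend on the instance suffices.\<close>

definition induces_P4 :: "('a \<Rightarrow> 'a \<Rightarrow> bool) \<Rightarrow> 'a set \<Rightarrow> bool" where
  "induces_P4 E V \<longleftrightarrow> (\<exists>a\<in>V. \<exists>b\<in>V. \<exists>c\<in>V. \<exists>d\<in>V. distinct [a, b, c, d] \<and>
     E a b \<and> E b c \<and> E c d \<and> \<not> E a c \<and> \<not> E a d \<and> \<not> E b d)"

lemma induces_P4I:
  "\<lbrakk>a \<in> V; b \<in> V; c \<in> V; d \<in> V; distinct [a, b, c, d];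
    E a b; E b c; E c d; \<not> E a c; \<not> E a d; \<not> E b d\<rbrakk> \<Longrightarrow> induces_P4 E V"
  unfolding induces_P4_def
  by (rule bexI[of _ a], rule bexI[of _ b], rule bexI[of _ c], rule bexI[of _ d]) simp_all

text \<open>For the complement of \<open>E\<close> this says that \<open>V\<close> is a join. Only
  arcs from \<open>A\<close> to \<open>B\<close> are excluded; the other direction comes from
  symmetry.\<close>

definition separated :: "('a \<Rightarrow> 'a \<Rightarrow> bool) \<Rightarrow> 'a set \<Rightarrow> bool" where
  "separated E V \<longleftrightarrow> (\<exists>A B. A \<noteq> {} \<and> B \<noteq> {} \<and> A \<inter> B = {} \<and> A \<union> B = V \<and> (\<forall>a\<in>A. \<forall>b\<in>B. \<not> E a b))"

lemma separatedI:
  "\<lbrakk>A \<noteq> {}; B \<noteq> {}; A \<inter> B = {}; A \<union> B = V; \<And>a b. a \<in> A \<Longrightarrow> b \<in> B \<Longrightarrow> \<not> E a b\<rbrakk> \<Longrightarrow> separated E V"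
  unfolding separated_def by (rule exI[of _ A], rule exI[of _ B]) simp

text \<open>The path on four vertices is self-complementary: the non-edges of a-b-c-d form the path
  c-a-d-b.\<close>

lemma induces_P4_complement:
  assumes "symp E" "induces_P4 (\<lambda>a b. \<not> E a b) V"
  shows "induces_P4 E V"
proof -
  obtain a b c d where *: "a \<in> V" "b \<in> V" "c \<in> V" "d \<in> V" "distinct [a, b, c, d]"
    "\<not> E a b" "\<not> E b c" "\<not> E c d" "E a c" "E a d" "E b d"
    using assms(2) unfolding induces_P4_def by metis
  then have "distinct [c, a, d, b]" "E c a" "E a d" "E d b" "\<not> E c d" "\<not> E c b" "\<not> E a b"
    using sympD[OF assms(1)] by auto
  with * show ?thesis by (intro induces_P4I[of c V a d b])
qed

text \<open>If \<open>v\<close> is adjacent to all of \<open>W\<close>, then \<open>{v}\<close> and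
  \<open>W\<close> form a join. Otherwise \<open>v\<close> has a non-neighbor on a side, say
  \<open>A\<close>. If \<open>v\<close> has no neighbor on one of the sides, it joins the opposite
  side; if it has neighbors on both, its non-neighbors in \<open>A\<close> can be split off from
  everything else.\<close>

lemma separated_insert:
  assumes "symp E" "\<not> induces_P4 E (insert v W)" "v \<notin> W" "separated E W"
  shows "separated E (insert v W) \<or> separated (\<lambda>a b. \<not> E a b) (insert v W)"
proof -
  note sym = sympD[OF assms(1)]
  obtain A B where AB: "A \<noteq> {}" "B \<noteq> {}" "A \<inter> B = {}" "A \<union> B = W" "\<forall>a\<in>A. \<forall>b\<in>B. \<not> E a b"
    using assms(4) unfolding separated_def by blast
  have key: "separated E (insert v W)"
    if AB: "A \<noteq> {}" "B \<noteq> {}" "A \<inter> B = {}" "A \<union> B = W" "\<forall>a\<in>A. \<forall>b\<in>B. \<not> E a b"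
      and w: "w \<in> A" "\<not> E v w" for A B w
  proof (cases "(\<forall>a\<in>A. \<not> E v a) \<or> (\<forall>b\<in>B. \<not> E v b)")
    case True
    then show ?thesis
    proof
      assume "\<forall>a\<in>A. \<not> E v a"
      with AB assms(3) show ?thesis
        by (intro separatedI[of A "insert v B"]) (auto dest: sym)
    next
      assume "\<forall>b\<in>B. \<not> E v b"
      with AB assms(3) show ?thesis
        by (intro separatedI[of "insert v A" B]) (auto dest: sym)
    qed
  next
    case False
    then obtain a c where ac: "a \<in> A" "E v a" "c \<in> B" "E v c" by blast
    \<comment> \<open>Such an edge would make \<open>b\<close>, \<open>a'\<close>, \<open>v\<close>,
      \<open>c\<close> an induced path, with \<open>c\<close> a neighbor of \<open>v\<close> across
      the split.\<close>
    have no: "\<not> E b a'" if "a' \<in> A" "E v a'" "b \<in> A" "\<not> E v b" for a' b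
    proof
      assume "E b a'"
      have "distinct [b, a', v, c]" using that ac AB assms(3) by auto
      moreover have "E a' v" "E v c" "\<not> E b v" "\<not> E b c" "\<not> E a' c"
        using that ac AB sym by blast+
      moreover have "b \<in> insert v W" "a' \<in> insert v W" "v \<in> insert v W" "c \<in> insert v W"
        using that ac AB by auto
      ultimately have "induces_P4 E (insert v W)"
        using \<open>E b a'\<close> by (intro induces_P4I[of b _ a' v c])
      with assms(2) show False by simp
    qed
    show ?thesis
    proof (rule separatedI[of "{b\<in>A. \<not> E v b}" "insert v (B \<union> {a\<in>A. E v a})"])
      show "{b\<in>A. \<not> E v b} \<noteq> {}" using w by blast
      show "{b\<in>A. \<not> E v b} \<inter> insert v (B \<union> {a\<in>A. E v a}) = {}" using AB assms(3) by auto
      show "{b\<in>A. \<not> E v b} \<union> insert v (B \<union> {a\<in>A. E v a}) = insert v W" using AB by auto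
      show "\<not> E a b" if "a \<in> {b\<in>A. \<not> E v b}" "b \<in> insert v (B \<union> {a\<in>A. E v a})" for a b
        using that AB no sym by blast
    qed simp
  qed
  show ?thesis
  proof (cases "\<forall>w\<in>W. E v w")
    case True
    then have "separated (\<lambda>a b. \<not> E a b) (insert v W)"
      using AB assms(3) by (intro separatedI[of "{v}" W]) auto
    then show ?thesis ..
  next
    case False
    then obtain w where "w \<in> W" "\<not> E v w" by blast
    then consider "w \<in> A" | "w \<in> B" using AB by blast
    then show ?thesis
    proof cases
      case 1
      then show ?thesis using key[of A B w] AB \<open>\<not> E v w\<close> by simp
    next
      case 2
      have "\<forall>b\<in>B. \<forall>a\<in>A. \<not> E b a" using AB sym by blast
      then show ?thesis using key[of B A w] AB \<open>\<not> E v w\<close> 2 by (simp add: Int_commute Un_commute)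
    qed
  qed
qed

text \<open>Seinsche's theorem. Hypothesis and conclusion are both invariant under complementation,
  so the case in which the complement of \<open>W\<close> splits is \<open>separated_insert\<close>
  for the complement.\<close>

theorem P4_free_separated:
  assumes "finite V" "2 \<le> card V" "symp E" "\<not> induces_P4 E V"
  shows "separated E V \<or> separated (\<lambda>a b. \<not> E a b) V"
  using assms
proof (induction V rule: finite_induct)
  case (insert v W)
  show ?case
  proof (cases "2 \<le> card W")
    case True
    let ?E' = "\<lambda>a b. \<not> E a b"
    have "\<not> induces_P4 E W"
    proof
      assume "induces_P4 E W"
      then have "induces_P4 E (insert v W)"
        unfolding induces_P4_def by (metis insertCI)
      with insert.prems show False by simp
    qed
    moreover have "symp ?E'" using insert.prems by (auto simp: symp_def)
    moreover have "\<not> induces_P4 ?E' (insert v W)"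
      using insert.prems induces_P4_complement by blast
    moreover have "separated E W \<or> separated ?E' W"
      using insert.IH insert.prems True calculation(1) by blast
    ultimately show ?thesis
      using separated_insert[OF insert.prems(2,3) insert.hyps(2)]
        separated_insert[of ?E', OF _ _ insert.hyps(2)] by auto
  next
    case False
    with insert.prems(1) insert.hyps have "card W = 1" by simp
    with insert.hyps obtain w where "W = {w}" "w \<noteq> v"
      by (metis card_1_singletonE singletonI)
    then show ?thesis
      by (cases "E v w") (auto intro!: separatedI[of "{v}" "{w}"])
  qed
qed simp

section \<open>Conflict-free two-colorings, given by their red class\<close>

definition conflict_free :: "'a set \<Rightarrow> ('a \<Rightarrow> 'a set) \<Rightarrow> 'a set \<Rightarrow> bool" where
  "conflict_free V N R \<longleftrightarrow> (\<forall>v\<in>V. card (N v \<inter> R) = 1 \<or> card (N v - R) = 1)"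

lemma conflict_free_complement:
  assumes "\<And>v. v \<in> V \<Longrightarrow> N v \<subseteq> V"
  shows "conflict_free V N (V - R) \<longleftrightarrow> conflict_free V N R"
proof -
  have "N v \<inter> (V - R) = N v - R" "N v - (V - R) = N v \<inter> R" if "v \<in> V" for v
    using assms[OF that] by auto
  then show ?thesis unfolding conflict_free_def by auto
qed

text \<open>Quadratically many candidates, each fixed by two vertices, so that the search for a
  two-coloring becomes two quantifiers over vertices. The case \<open>x = y\<close> covers
  singletons.\<close>

definition canonical_red :: "'a set \<Rightarrow> ('a \<Rightarrow> 'a set) \<Rightarrow> 'a set \<Rightarrow> bool" where
  "canonical_red V N R \<longleftrightarrow> (\<exists>x\<in>V. \<exists>y\<in>V. R = {x, y} \<or> R = N x - {y})"

lemma card_le_2_cases: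
  assumes "finite R" "card R \<le> 2" "R \<noteq> {}"
  obtains x y where "R = {x, y}"
proof -
  have "card R \<noteq> 0" using assms by simp
  then have "card R = 1 \<or> card R = 2" using assms by linarith
  then show thesis using that by (metis card_1_singletonE card_2_iff insert_absorb2)
qed

text \<open>Covers open and closed neighborhoods of a join simultaneously; \<open>refl\<close> is
  all that remains of the distinction.\<close>

locale joined_nbhds =
  fixes V A B :: "'a set" and N :: "'a \<Rightarrow> 'a set"
  assumes fin: "finite V"
    and sub: "\<And>v. v \<in> V \<Longrightarrow> N v \<subseteq> V"
    and sym: "\<And>u v. u \<in> V \<Longrightarrow> v \<in> N u \<Longrightarrow> u \<in> N v"
    and refl: "(\<forall>v\<in>V. v \<in> N v) \<or> (\<forall>v\<in>V. v \<notin> N v)"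
    and join: "A \<noteq> {}" "B \<noteq> {}" "A \<inter> B = {}" "A \<union> B = V"
      "\<And>a. a \<in> A \<Longrightarrow> B \<subseteq> N a" "\<And>b. b \<in> B \<Longrightarrow> A \<subseteq> N b"
begin

lemma finite_sides: "finite A" "finite B"
  using fin join(4) by auto

lemma card_inter_join:
  assumes "v \<in> A"
  shows "card (N v \<inter> R) = card (N v \<inter> A \<inter> R) + card (B \<inter> R)"
    and "card (N v - R) = card ((N v \<inter> A) - R) + card (B - R)"
proof -
  have "N v \<subseteq> A \<union> B" "B \<subseteq> N v" using assms sub[of v] join by auto
  then have "N v \<inter> R = (N v \<inter> A \<inter> R) \<union> (B \<inter> R)" "N v - R = ((N v \<inter> A) - R) \<union> (B - R)"
    by auto
  moreover have "(N v \<inter> A \<inter> R) \<inter> (B \<inter> R) = {}" "((N v \<inter> A) - R) \<inter> (B - R) = {}"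
    using join(3) by auto
  ultimately show "card (N v \<inter> R) = card (N v \<inter> A \<inter> R) + card (B \<inter> R)"
    and "card (N v - R) = card ((N v \<inter> A) - R) + card (B - R)"
    using finite_sides by (simp_all add: card_Un_disjoint)
qed

lemma few_of_one_color:
  assumes "conflict_free V N R"
  shows "card (B \<inter> R) \<le> 1 \<or> card (B - R) \<le> 1"
proof -
  obtain a where "a \<in> A" using join(1) by auto
  then have "a \<in> V" using join(4) by auto
  with assms have "card (N a \<inter> R) = 1 \<or> card (N a - R) = 1" by (simp add: conflict_free_def)
  then show ?thesis using card_inter_join[OF \<open>a \<in> A\<close>, of R] by auto
qed

text \<open>Only the empty class is not of the form \<open>{x, y}\<close>. With no red vertex every
  \<open>N v\<close> is a singleton, which forces both sides to be singletons; then everything can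
  be colored red instead.\<close>

lemma canonical_of_small:
  assumes "conflict_free V N R" "R \<subseteq> V" "card R \<le> 2"
  shows "\<exists>R. canonical_red V N R \<and> conflict_free V N R"
proof (cases "R = {}")
  case False
  then obtain x y where "R = {x, y}"
    using assms finite_subset[OF _ fin] card_le_2_cases by metis
  then show ?thesis using assms by (auto simp: canonical_red_def)
next
  case True
  obtain a b where ab: "a \<in> A" "b \<in> B" using join by auto
  have *: "card (N v) = 1" if "v \<in> V" for v
    using assms that True by (auto simp: conflict_free_def)
  have "N a = {b}" "N b = {a}"
    using *[of a] *[of b] ab join card_1_singletonE by (metis UnI1 UnI2 singletonD subsetD)+
  with ab join have "V = {a, b}" by fastforce
  with * \<open>N a = {b}\<close> \<open>N b = {a}\<close> have "conflict_free V N {a, b}"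
    by (simp add: conflict_free_def)
  with \<open>V = {a, b}\<close> show ?thesis by (auto simp: canonical_red_def)
qed

text \<open>Every vertex of \<open>A\<close> sees at least two red vertices in \<open>B\<close>, so
  it sees exactly one blue vertex, and that one lies in \<open>A\<close>. If \<open>A\<close> has no
  red vertex, any \<open>x \<in> A\<close> yields \<open>N x = insert y B\<close> with
  \<open>y\<close> its blue neighbor. If \<open>z\<close> is the red vertex of \<open>A\<close>, the
  right choice for \<open>x\<close> is the blue neighbor of \<open>z\<close>.\<close>

lemma canonical_of_mixed:
  assumes cf: "conflict_free V N R" and R: "R \<subseteq> V"
    and A: "card (A \<inter> R) \<le> 1" "2 \<le> card (A - R)"
    and B: "B \<subseteq> R" "2 \<le> card B"
  shows "canonical_red V N R"
proof -
  have one: "card ((N v \<inter> A) - R) = 1" if "v \<in> A" for v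
  proof -
    have "B \<inter> R = B" "card (B - R) = 0" using B by (auto simp: Diff_eq_empty_iff[THEN iffD2])
    then have "card (N v \<inter> R) \<noteq> 1" "card (N v - R) = card ((N v \<inter> A) - R)"
      using card_inter_join[OF that, of R] B by auto
    moreover have "v \<in> V" using that join by auto
    ultimately show ?thesis using cf by (auto simp: conflict_free_def)
  qed
  have N: "N v = (N v \<inter> A) \<union> B" if "v \<in> A" for v
    using that sub[of v] join by auto
  show ?thesis
  proof (cases "A \<inter> R = {}")
    case True
    obtain x where x: "x \<in> A" using join by auto
    then obtain y where y: "N x \<inter> A - R = {y}" using one card_1_singletonE by metis
    then have "N x = insert y B" "y \<notin> B" using N[OF x] True join by auto
    moreover have "R = B" using R B True join by auto
    moreover have "x \<in> V" "y \<in> V" using x y join by auto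
    ultimately show ?thesis unfolding canonical_red_def by blast
  next
    case False
    then have "card (A \<inter> R) = 1" using A finite_sides
      by (metis One_nat_def Suc_leI card_gt_0_iff finite_Int le_antisym)
    then obtain z where z: "A \<inter> R = {z}" using card_1_singletonE by metis
    then have zA: "z \<in> A" by auto
    then obtain x where x: "N z \<inter> A - R = {x}" using one card_1_singletonE by metis
    then have xA: "x \<in> A" by auto
    then obtain y where y: "N x \<inter> A - R = {y}" using one card_1_singletonE by metis
    \<comment> \<open>By symmetry \<open>N x\<close> meets \<open>A\<close> exactly in
      \<open>z\<close> and \<open>y\<close>. For closed neighborhoods \<open>y\<close> is
      \<open>x\<close> itself.\<close>
    have "z \<in> N x" using sym[of z x] x zA join(4) by blast
    have "N x \<inter> A = {z, y}"
    proof -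
      have "N x \<inter> A = (N x \<inter> A - R) \<union> (N x \<inter> (A \<inter> R))" by blast
      also have "\<dots> = {z, y}" unfolding y z using \<open>z \<in> N x\<close> by auto
      finally show ?thesis .
    qed
    then have "N x = insert z (insert y B)" using N[OF xA] by auto
    moreover have "y \<noteq> z" "y \<notin> B" using y z join by auto
    moreover have "R = insert z B" using R B z join by auto
    moreover have "x \<in> V" "y \<in> V" using xA y join by auto
    ultimately have "R = N x - {y}" "x \<in> V" "y \<in> V" by auto
    then show ?thesis unfolding canonical_red_def by blast
  qed
qed

text \<open>A vertex of \<open>A\<close> sees at least two red vertices and the blue
  \<open>w\<close>, so \<open>w\<close> is its only blue neighbor and it sees no blue vertex of
  \<open>A\<close>. A blue vertex of \<open>A\<close> seeing \<open>z\<close> would by symmetry be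
  seen by \<open>z\<close>.\<close>

lemma avoid_in_side:
  assumes cf: "conflict_free V N R"
    and A: "A \<inter> R = {z}" "2 \<le> card (A - R)"
    and B: "B - R = {w}" "2 \<le> card (B \<inter> R)"
    and v: "v \<in> A"
  shows "z \<notin> N v"
proof
  assume "z \<in> N v"
  have none: "u \<notin> N v'" if "v' \<in> A" "u \<in> A - R" for u v'
  proof -
    have "card (N v' \<inter> R) \<noteq> 1" "card (N v' - R) = card ((N v' \<inter> A) - R) + 1"
      using card_inter_join[OF that(1), of R] B by auto
    moreover have "v' \<in> V" using that join by auto
    ultimately have "card ((N v' \<inter> A) - R) = 0" using cf by (auto simp: conflict_free_def)
    then have "(N v' \<inter> A) - R = {}" using finite_sides by simp
    then show ?thesis using that by auto
  qed
  have "v \<in> V" using v join by auto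
  with \<open>z \<in> N v\<close> have "v \<in> N z" using sym by auto
  moreover have z: "z \<in> A" "z \<in> V" using A join by auto
  ultimately have "v = z" using none[of z v] v A by auto
  \<comment> \<open>Only \<open>z\<close> seeing itself is left. Then all neighborhoods are closed,
    and a blue vertex of \<open>A\<close> sees itself.\<close>
  with \<open>z \<in> N v\<close> have "\<forall>v\<in>V. v \<in> N v" using refl \<open>v \<in> V\<close> by auto
  moreover obtain b where "b \<in> A - R" using A(2) by (cases "A - R = {}") auto
  ultimately show False using none[of b b] join by auto
qed

lemma swap: "joined_nbhds V B A N"
proof
  show "B \<inter> A = {}" "B \<union> A = V" using join(3,4) by auto
qed (fact fin sub sym refl join)+

lemma canonical_of_conflict_free:
  assumes cf: "conflict_free V N R" "R \<subseteq> V"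
  shows "\<exists>R. canonical_red V N R \<and> conflict_free V N R"
proof -
  interpret BA: joined_nbhds V B A N by (rule swap)
  have compl: "conflict_free V N (V - R)" if "conflict_free V N R" for R
    using conflict_free_complement[of V N R, OF sub] that by blast
  note finAB = finite_sides
  have mixed: ?thesis
    if cf: "conflict_free V N R" and R: "R \<subseteq> V" and c: "card (A \<inter> R) \<le> 1" "card (B - R) \<le> 1" for R
  proof (cases "card R \<le> 2 \<or> card (V - R) \<le> 2")
    case True
    then show ?thesis
      using canonical_of_small[OF cf R] canonical_of_small[OF compl[OF cf]] by blast
  next
    case False
    have "R = (A \<inter> R) \<union> (B \<inter> R)" "V - R = (A - R) \<union> (B - R)" using R join by auto
    then have "card R \<le> card (A \<inter> R) + card (B \<inter> R)" "card (V - R) \<le> card (A - R) + card (B - R)"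
      by (metis card_Un_le)+
    \<comment> \<open>Each class has at least three vertices, at most one of which is an exception
      on the side of the other color.\<close>
    with False c have big: "2 \<le> card (B \<inter> R)" "2 \<le> card (A - R)" by linarith+
    consider "B - R = {}" | "A \<inter> R = {}" | "A \<inter> R \<noteq> {}" "B - R \<noteq> {}" by blast
    then show ?thesis
    proof cases
      case 1
      then have "B \<subseteq> R" "B \<inter> R = B" by auto
      then show ?thesis
        using canonical_of_mixed[OF cf R c(1) big(2)] big cf by auto
    next
      case 2
      have eq: "B \<inter> (V - R) = B - R" "B - (V - R) = B \<inter> R" using join by auto
      have "A \<subseteq> V - R" "A - R = A" using 2 join by auto
      \<comment> \<open>Here \<open>A\<close> is entirely blue, which is the case above with both
        the sides and the colors exchanged.\<close>
      then have "canonical_red V N (V - R)"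
        using BA.canonical_of_mixed[OF compl[OF cf]] eq big c by auto
      then show ?thesis using compl[OF cf] by blast
    next
      case 3
      then have "card (A \<inter> R) = 1" "card (B - R) = 1"
        using c finAB by (metis One_nat_def Suc_leI card_gt_0_iff finite_Int finite_Diff le_antisym)+
      then obtain z w where zw: "A \<inter> R = {z}" "B - R = {w}" using card_1_singletonE by metis
      have eq: "B \<inter> (V - R) = B - R" "B - (V - R) = B \<inter> R" "A \<inter> (V - R) = A - R"
        "A - (V - R) = A \<inter> R" using join by auto
      have zA: "z \<notin> N v" if "v \<in> A" for v
        using avoid_in_side[OF cf zw(1) big(2) zw(2) big(1) that] .
      have wB: "w \<notin> N v" if "v \<in> B" for v
        using BA.avoid_in_side[OF compl[OF cf] _ _ _ _ that, of w z] zw big by (simp add: eq)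
      have mem: "z \<in> A" "w \<in> B" using zw by auto
      have "N v \<inter> {z, w} = {w}" if "v \<in> A" for v
        using zA[OF that] mem that join by blast
      moreover have "N v \<inter> {z, w} = {z}" if "v \<in> B" for v
        using wB[OF that] mem that join by blast
      \<comment> \<open>The given coloring is abandoned: recoloring all but the two exceptions blue
        leaves every vertex with exactly one red neighbor, the exception of the opposite
        side.\<close>
      ultimately have "conflict_free V N {z, w}"
        using join(4) by (auto simp: conflict_free_def)
      then show ?thesis using mem join unfolding canonical_red_def by blast
    qed
  qed
  have eq: "B \<inter> (V - R) = B - R" "B - (V - R) = B \<inter> R" "A \<inter> (V - R) = A - R"
        "A - (V - R) = A \<inter> R" using join by auto
  have "R = (A \<inter> R) \<union> (B \<inter> R)" "V - R = (A - R) \<union> (B - R)" using cf(2) join by auto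
  then have le: "card R \<le> card (A \<inter> R) + card (B \<inter> R)" "card (V - R) \<le> card (A - R) + card (B - R)"
    by (metis card_Un_le)+
  consider "card (A \<inter> R) \<le> 1" "card (B \<inter> R) \<le> 1" | "card (A - R) \<le> 1" "card (B - R) \<le> 1"
    | "card (A \<inter> R) \<le> 1" "card (B - R) \<le> 1" | "card (A - R) \<le> 1" "card (B \<inter> R) \<le> 1"
    using few_of_one_color[OF cf(1)] BA.few_of_one_color[OF cf(1)] by blast
  then show ?thesis
  proof cases
    case 1
    with le have "card R \<le> 2" by linarith
    with cf show ?thesis by (rule canonical_of_small)
  next
    case 2
    with le have "card (V - R) \<le> 2" by linarith
    then show ?thesis using canonical_of_small[OF compl[OF cf(1)]] by blast
  next
    case 3
    then show ?thesis using mixed[OF cf] by blast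
  next
    case 4
    then show ?thesis using mixed[OF compl[OF cf(1)]] eq by auto
  qed
qed

end

section \<open>Colorability of connected cographs\<close>

definition nbhd :: "bool \<Rightarrow> 'a pair_pre_digraph \<Rightarrow> 'a \<Rightarrow> 'a set" where
  "nbhd cl G v = (if cl then closed_nbhd G v else open_nbhd G v)"

definition colorable :: "'a set \<Rightarrow> ('a \<Rightarrow> 'a set) \<Rightarrow> int \<Rightarrow> bool" where
  "colorable V N k \<longleftrightarrow> (\<exists>C. C ` V \<subseteq> {1..k} \<and> (\<forall>v\<in>V. has_unique_color C (N v)))"

lemma colorableI:
  "\<lbrakk>\<And>v. v \<in> V \<Longrightarrow> 1 \<le> C v \<and> C v \<le> k; \<And>v. v \<in> V \<Longrightarrow> \<exists>c. card {u \<in> N v. C u = c} = 1\<rbrakk> \<Longrightarrow> colorable V N k"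
  unfolding colorable_def has_unique_color_def by (intro exI[of _ C]) auto

lemma colorable_1:
  assumes "\<And>v. v \<in> V \<Longrightarrow> N v \<subseteq> V"
  shows "colorable V N 1 \<longleftrightarrow> (\<forall>v\<in>V. card (N v) = 1)"
proof
  assume "colorable V N 1"
  then obtain C where C: "C ` V \<subseteq> {1..1::int}" "\<forall>v\<in>V. \<exists>c. card {u \<in> N v. C u = c} = 1"
    unfolding colorable_def has_unique_color_def by blast
  show "\<forall>v\<in>V. card (N v) = 1"
  proof
    fix v assume "v \<in> V"
    with C obtain c where c: "card {u \<in> N v. C u = c} = 1" by blast
    then obtain u where "u \<in> N v" "C u = c" by (metis (mono_tags, lifting) card_1_singletonE insertI1 mem_Collect_eq)
    have "C u = 1" if "u \<in> N v" for u using C(1) assms[OF \<open>v \<in> V\<close>] that by force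
    then have "{u \<in> N v. C u = c} = N v" using \<open>u \<in> N v\<close> \<open>C u = c\<close> by auto
    with c show "card (N v) = 1" by simp
  qed
next
  assume "\<forall>v\<in>V. card (N v) = 1"
  then show "colorable V N 1"
    by (intro colorableI[of _ "\<lambda>_. 1"]) (auto intro: exI[of _ 1])
qed

lemma colorable_mono: "colorable V N k \<Longrightarrow> k \<le> k' \<Longrightarrow> colorable V N k'"
  unfolding colorable_def by (meson atLeastatMost_subset_iff order_refl order_trans)

lemma colorable_2:
  assumes "\<And>v. v \<in> V \<Longrightarrow> N v \<subseteq> V"
  shows "colorable V N 2 \<longleftrightarrow> (\<exists>R\<subseteq>V. conflict_free V N R)"
proof
  assume "colorable V N 2"
  then obtain C where C: "C ` V \<subseteq> {1..2::int}" "\<forall>v\<in>V. \<exists>c. card {u \<in> N v. C u = c} = 1"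
    unfolding colorable_def has_unique_color_def by blast
  have "conflict_free V N {v \<in> V. C v = 1}"
    unfolding conflict_free_def
  proof
    fix v assume v: "v \<in> V"
    with C obtain c where c: "card {u \<in> N v. C u = c} = 1" by blast
    then obtain u where "u \<in> N v" "C u = c" by (metis (mono_tags, lifting) card_1_singletonE insertI1 mem_Collect_eq)
    then have "u \<in> V" using assms[OF v] by auto
    have C12: "C u = 1 \<or> C u = 2" if "u \<in> V" for u
    proof -
      have "C u \<in> {1..2}" using C(1) that by auto
      then show ?thesis by auto
    qed
    with \<open>u \<in> V\<close> \<open>C u = c\<close> have "c = 1 \<or> c = 2" by auto
    moreover have "{u \<in> N v. C u = 1} = N v \<inter> {v \<in> V. C v = 1}"
      using assms[OF v] by auto
    moreover have "{u \<in> N v. C u = 2} = N v - {v \<in> V. C v = 1}"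
      using assms[OF v] C12 by fastforce
    ultimately show "card (N v \<inter> {v \<in> V. C v = 1}) = 1 \<or> card (N v - {v \<in> V. C v = 1}) = 1"
      using c by auto
  qed
  then show "\<exists>R\<subseteq>V. conflict_free V N R" by (intro exI[of _ "{v \<in> V. C v = 1}"]) simp
next
  assume "\<exists>R\<subseteq>V. conflict_free V N R"
  then obtain R where R: "conflict_free V N R" by blast
  let ?C = "\<lambda>u. if u \<in> R then 1 else 2 :: int"
  show "colorable V N 2"
  proof (rule colorableI[of _ ?C])
    fix v assume "v \<in> V"
    have "{u \<in> N v. ?C u = 1} = N v \<inter> R" "{u \<in> N v. ?C u = 2} = N v - R" by auto
    moreover have "card (N v \<inter> R) = 1 \<or> card (N v - R) = 1"
      using R \<open>v \<in> V\<close> by (simp add: conflict_free_def)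
    ultimately have "card {u \<in> N v. ?C u = 1} = 1 \<or> card {u \<in> N v. ?C u = 2} = 1" by simp
    then show "\<exists>c. card {u \<in> N v. ?C u = c} = 1" by blast
  qed auto
qed

lemma colorable_nonempty: "colorable V N k \<Longrightarrow> v \<in> V \<Longrightarrow> N v \<noteq> {}"
  unfolding colorable_def has_unique_color_def by fastforce

lemma (in joined_nbhds) colorable_3: "colorable V N 3"
proof -
  obtain a b where ab: "a \<in> A" "b \<in> B" using join by auto
  let ?C = "\<lambda>v. if v = a then 1 else if v = b then 2 else 3 :: int"
  show ?thesis
  proof (rule colorableI[of _ ?C])
    fix v assume "v \<in> V"
    then consider "v \<in> A" | "v \<in> B" using join by auto
    then show "\<exists>c. card {u \<in> N v. ?C u = c} = 1"
    proof cases
      case 1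
      then have "b \<in> N v" "a \<noteq> b" using join(3) join(5)[OF 1] ab by blast+
      then have "{u \<in> N v. ?C u = 2} = {b}" by auto
      then show ?thesis by (intro exI[of _ 2]) simp
    next
      case 2
      then have "a \<in> N v" using join(6)[OF 2] ab by blast
      then have "{u \<in> N v. ?C u = 1} = {a}" by auto
      then show ?thesis by (intro exI[of _ 1]) simp
    qed
  qed auto
qed

text \<open>\<open>connected\<close> means reachability in the symmetric closure. A set without arcs
  to the rest is, by symmetry, closed under its steps, so a walk that starts in \<open>A\<close>
  stays there.\<close>

lemma connected_not_separated:
  fixes G :: "'a pair_pre_digraph"
  assumes "connected G" "symp (\<lambda>u v. (u, v) \<in> parcs G)"
  shows "\<not> separated (\<lambda>u v. (u, v) \<in> parcs G) (pverts G)"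
proof
  let ?H = "mk_symmetric (with_proj G)"
  assume "separated (\<lambda>u v. (u, v) \<in> parcs G) (pverts G)"
  then obtain A B where AB: "A \<noteq> {}" "B \<noteq> {}" "A \<inter> B = {}" "A \<union> B = pverts G"
    "\<forall>a\<in>A. \<forall>b\<in>B. (a, b) \<notin> parcs G"
    unfolding separated_def by blast
  obtain a b where ab: "a \<in> A" "b \<in> B" using AB by blast
  have "verts (with_proj ?H) = pverts G" by (simp add: mk_symmetric_def)
  moreover have "a \<in> pverts G" "b \<in> pverts G" using ab AB by auto
  ultimately have "reachable (with_proj ?H) a b"
    using assms(1) unfolding connected_def strongly_connected_def by simp
  then have "(a, b) \<in> rtrancl_on (pverts G) (parcs ?H)"
    unfolding reachable_def by (simp add: mk_symmetric_def)
  then have "b \<in> A"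
  proof (induction rule: rtrancl_on_induct)
    case (step y z)
    then have "(y, z) \<in> parcs G \<or> (z, y) \<in> parcs G" by (auto simp: mk_symmetric_def)
    then have "(y, z) \<in> parcs G" using sympD[OF assms(2)] by blast
    with step AB show ?case by blast
  qed (use ab in auto)
  with ab AB show False by blast
qed

context
  fixes G :: "'a pair_pre_digraph" and cl :: bool
  assumes G: "cograph G" "connected G"
begin

lemma nbhd_iff: "v \<in> pverts G \<Longrightarrow> u \<in> nbhd cl G v \<longleftrightarrow> u \<in> pverts G \<and> ((v, u) \<in> parcs G \<or> cl \<and> v = u)"
  by (auto simp: nbhd_def closed_nbhd_def open_nbhd_def)

lemma cograph_facts:
  shows "finite (pverts G)" and "symp (\<lambda>u v. (u, v) \<in> parcs G)" and "(v, v) \<notin> parcs G"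
    and "\<not> induces_P4 (\<lambda>u v. (u, v) \<in> parcs G) (pverts G)"
proof -
  interpret pair_graph G using G by (simp add: cograph_def)
  show "finite (pverts G)" by simp
  show "symp (\<lambda>u v. (u, v) \<in> parcs G)"
    using pair_sym_arcs by (auto simp: symmetric_def sym_def symp_def)
  show "(v, v) \<notin> parcs G" using pair_no_loops[of "(v, v)"] by auto
  show "\<not> induces_P4 (\<lambda>u v. (u, v) \<in> parcs G) (pverts G)"
    using G unfolding cograph_def P4_free_def induces_P4_def by simp
qed

lemma ex_joined_nbhds:
  assumes "2 \<le> card (pverts G)"
  shows "\<exists>A B. joined_nbhds (pverts G) A B (nbhd cl G)"
proof -
  note sym = sympD[OF cograph_facts(2)]
  have "separated (\<lambda>u v. (u, v) \<notin> parcs G) (pverts G)"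
    using P4_free_separated[OF cograph_facts(1) assms cograph_facts(2,4)]
      connected_not_separated[OF G(2) cograph_facts(2)] by blast
  then obtain A B where AB: "A \<noteq> {}" "B \<noteq> {}" "A \<inter> B = {}" "A \<union> B = pverts G"
    "\<forall>a\<in>A. \<forall>b\<in>B. (a, b) \<in> parcs G"
    unfolding separated_def not_not by (elim exE conjE)
  have "joined_nbhds (pverts G) A B (nbhd cl G)"
  proof
    show "nbhd cl G v \<subseteq> pverts G" if "v \<in> pverts G" for v
      using nbhd_iff[OF that] by blast
    show "u \<in> nbhd cl G v" if "u \<in> pverts G" "v \<in> nbhd cl G u" for u v
    proof -
      have "v \<in> pverts G" "(u, v) \<in> parcs G \<or> cl \<and> u = v" using nbhd_iff[OF that(1)] that(2) by auto
      then show ?thesis using nbhd_iff[of v u] that(1) sym by auto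
    qed
    show "(\<forall>v\<in>pverts G. v \<in> nbhd cl G v) \<or> (\<forall>v\<in>pverts G. v \<notin> nbhd cl G v)"
      using nbhd_iff cograph_facts(3) by (cases cl) auto
    show "B \<subseteq> nbhd cl G a" if "a \<in> A" for a
    proof -
      have "a \<in> pverts G" "B \<subseteq> pverts G" using that AB by auto
      with that AB nbhd_iff[of a] show ?thesis by blast
    qed
    show "A \<subseteq> nbhd cl G b" if "b \<in> B" for b
    proof -
      have "b \<in> pverts G" "A \<subseteq> pverts G" using that AB by auto
      moreover have "(b, a) \<in> parcs G" if "a \<in> A" for a
        using \<open>b \<in> B\<close> that AB sym by blast
      ultimately show ?thesis using nbhd_iff[of b] by blast
    qed
  qed (use AB cograph_facts(1) in simp_all)
  then show ?thesis by blast
qed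

text \<open>The right side mentions \<open>k\<close> only in three comparisons and quantifies over
  vertices and canonical classes only, so it can be tested by a fixed first-order formula. A
  nonempty \<open>V\<close> supplies \<open>1 \<le> k\<close> in the forward direction.\<close>

lemma colorable_iff:
  "colorable (pverts G) (nbhd cl G) k \<longleftrightarrow>
     1 \<le> k \<and> (\<forall>v\<in>pverts G. card (nbhd cl G v) = 1) \<or>
     2 \<le> k \<and> (\<exists>R. canonical_red (pverts G) (nbhd cl G) R \<and> conflict_free (pverts G) (nbhd cl G) R) \<or>
     3 \<le> k \<and> (\<forall>v\<in>pverts G. nbhd cl G v \<noteq> {})"
    (is "?L \<longleftrightarrow> 1 \<le> k \<and> ?one \<or> 2 \<le> k \<and> ?two \<or> 3 \<le> k \<and> ?three")
proof -
  let ?V = "pverts G" and ?N = "nbhd cl G"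
  have sub: "\<And>v. v \<in> ?V \<Longrightarrow> ?N v \<subseteq> ?V" using nbhd_iff by blast
  have col2: "colorable ?V ?N 2 \<longleftrightarrow> (\<exists>R\<subseteq>?V. conflict_free ?V ?N R)"
    by (rule colorable_2) (rule sub)
  have canon_sub: "R \<subseteq> ?V" if can: "canonical_red ?V ?N R" for R
  proof -
    obtain x y where "x \<in> ?V" "y \<in> ?V" "R = {x, y} \<or> R = ?N x - {y}"
      using can unfolding canonical_red_def by metis
    then show ?thesis using sub[of x] by auto
  qed
  have "?V \<noteq> {}" using G(2) by (auto simp: connected_def strongly_connected_def mk_symmetric_def)
  then obtain v0 where v0: "v0 \<in> ?V" by blast
  have "card ?V \<noteq> 0" using \<open>?V \<noteq> {}\<close> cograph_facts(1) by simp
  \<comment> \<open>A graph with a single vertex is not a join. There, a nonempty neighborhood is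
    the vertex itself, so three colors never help where one does not.\<close>
  have single: "?one" if "card ?V < 2" ?three
  proof
    fix v assume v: "v \<in> ?V"
    have "card ?V = 1" using \<open>card ?V \<noteq> 0\<close> that(1) by linarith
    then obtain w where "?V = {w}" by (rule card_1_singletonE)
    with v have "?V = {v}" by simp
    moreover have "?N v \<subseteq> ?V" "?N v \<noteq> {}" using sub[OF v] that(2) v by simp_all
    ultimately have "?N v = {v}" by (simp add: subset_singleton_iff)
    then show "card (?N v) = 1" by simp
  qed
  have two: "colorable ?V ?N 2 \<longleftrightarrow> ?two" if ge2: "2 \<le> card ?V"
  proof -
    obtain A B where "joined_nbhds ?V A B ?N" using ex_joined_nbhds[OF ge2] by blast
    then interpret joined_nbhds ?V A B ?N .
    show ?thesis
      unfolding col2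
      using canonical_of_conflict_free canon_sub by metis
  qed
  have three: "colorable ?V ?N 3" if ge2: "2 \<le> card ?V"
  proof -
    obtain A B where "joined_nbhds ?V A B ?N" using ex_joined_nbhds[OF ge2] by blast
    then show ?thesis by (rule joined_nbhds.colorable_3)
  qed
  have one: "colorable ?V ?N 1 \<longleftrightarrow> ?one" by (rule colorable_1) (rule sub)
  have two': "colorable ?V ?N 2" if ?two
    unfolding col2 using that canon_sub by metis
  show ?thesis
  proof
    assume L: ?L
    have three': "?three" using colorable_nonempty[OF L] by (intro ballI)
    obtain C where "C ` ?V \<subseteq> {1..k}" using L unfolding colorable_def by blast
    with v0 have "1 \<le> k" by force
    show "1 \<le> k \<and> ?one \<or> 2 \<le> k \<and> ?two \<or> 3 \<le> k \<and> ?three"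
    proof (cases "card ?V < 2")
      case True
      show ?thesis using single[OF True three'] \<open>1 \<le> k\<close> by (intro disjI1 conjI)
    next
      case False
      consider "k = 1" | "k = 2" | "3 \<le> k" using \<open>1 \<le> k\<close> by linarith
      then show ?thesis
      proof cases
        case 1
        then have ?one using one L by simp
        with \<open>1 \<le> k\<close> show ?thesis by (intro disjI1 conjI)
      next
        case 2
        then have ?two using two False L by simp
        with 2 show ?thesis by (intro disjI2 disjI1 conjI) simp_all
      next
        case 3
        then show ?thesis using three' by (intro disjI2 conjI)
      qed
    qed
  next
    assume "1 \<le> k \<and> ?one \<or> 2 \<le> k \<and> ?two \<or> 3 \<le> k \<and> ?three"
    then consider "1 \<le> k" ?one | "2 \<le> k" ?two | "3 \<le> k" ?three by (elim disjE conjE)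
    then show ?L
    proof cases
      case 1
      then show ?thesis using colorable_mono[of ?V ?N 1 k] one by simp
    next
      case 2
      then show ?thesis using colorable_mono[OF two'] by simp
    next
      case 3
      then have "1 \<le> k" by simp
      show ?thesis
      proof (cases "card ?V < 2")
        case True
        have "colorable ?V ?N 1" using single[OF True 3(2)] one by simp
        then show ?thesis using \<open>1 \<le> k\<close> by (rule colorable_mono)
      next
        case False
        then have "colorable ?V ?N 3" using three by simp
        then show ?thesis using 3(1) by (rule colorable_mono)
      qed
    qed
  qed
qed

end

section \<open>Programs for Turing machines\<close>

text \<open>
  Commands never change a tape, so a configuration is a stack of commands together with the head
  positions, and the heads of the blank work tapes serve as counters: the mark in cell 0 makes
  zero testable, and a left move is truncated subtraction.
\<close>

datatype cmd =
    Move nat move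
  | Seq cmd cmd (infixr ";;" 60)
  | If_Sym nat nat cmd cmd
  | Until nat nat cmd
  | Accept
  | Reject

primrec tapes :: "cmd \<Rightarrow> nat set" where
  "tapes (Move i m) = {i}"
| "tapes (p ;; q) = tapes p \<union> tapes q"
| "tapes (If_Sym i a p q) = insert i (tapes p \<union> tapes q)"
| "tapes (Until i a p) = insert i (tapes p)"
| "tapes Accept = {}"
| "tapes Reject = {}"

fun next_stack :: "cmd list \<Rightarrow> (nat \<Rightarrow> nat) \<Rightarrow> cmd list" where
  "next_stack [] f = []"
| "next_stack (Move i m # ks) f = ks"
| "next_stack ((p ;; q) # ks) f = p # q # ks"
| "next_stack (If_Sym i a p q # ks) f = (if f i = a then p else q) # ks"
| "next_stack (Until i a p # ks) f = (if f i = a then ks else p # Until i a p # ks)"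
| "next_stack (Accept # ks) f = Accept # ks"
| "next_stack (Reject # ks) f = Reject # ks"

fun stack_move :: "cmd list \<Rightarrow> nat \<Rightarrow> move" where
  "stack_move (Move j m # ks) i = (if i = j then m else Stay)"
| "stack_move ks i = Stay"

definition cell :: "bool list \<Rightarrow> nat \<Rightarrow> nat \<Rightarrow> nat" where
  "cell xs i = fst (init_tape (if i = 0 then xs else []))"

definition stack_step :: "bool list \<Rightarrow> cmd list \<times> (nat \<Rightarrow> nat) \<Rightarrow> cmd list \<times> (nat \<Rightarrow> nat)" where
  "stack_step xs c = (next_stack (fst c) (\<lambda>i. cell xs i (snd c i)),
     \<lambda>i. move_head (stack_move (fst c) i) (snd c i))"

text \<open>The step count is fixed before \<open>ks\<close>: the same run takes place on top of
  every continuation, which is what lets runs be composed.\<close>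

definition runs :: "bool list \<Rightarrow> cmd \<Rightarrow> (nat \<Rightarrow> nat) \<Rightarrow> nat \<Rightarrow> (nat \<Rightarrow> nat) \<Rightarrow> bool" where
  "runs xs p s T s' \<longleftrightarrow> (\<exists>t\<le>T. \<forall>ks. (stack_step xs ^^ t) (p # ks, s) = (ks, s'))"

lemma runs_weaken: "\<lbrakk>runs xs p s T s'; T \<le> T'; s' = s''\<rbrakk> \<Longrightarrow> runs xs p s T' s''"
  unfolding runs_def using order_trans by blast

lemma runs_Move: "runs xs (Move i m) s 1 (s(i := move_head m (s i)))"
  unfolding runs_def by (intro exI[of _ 1]) (auto simp: stack_step_def)

lemma runs_prepend:
  assumes "\<And>ks. stack_step xs (p # ks, s) = (qs @ ks, s)"
    and "\<And>ks. (stack_step xs ^^ t) (qs @ ks, s) = (ks, s')" "t < T"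
  shows "runs xs p s T s'"
  unfolding runs_def using assms
  by (intro exI[of _ "Suc t"]) (simp add: funpow_swap1 del: funpow.simps(2) add: funpow_Suc_right)

lemma runs_Seq:
  assumes "runs xs p s T s'" "runs xs q s' T' s''"
  shows "runs xs (p ;; q) s (Suc (T + T')) s''"
proof -
  obtain t t' where t: "t \<le> T" "\<And>ks. (stack_step xs ^^ t) (p # ks, s) = (ks, s')"
    "t' \<le> T'" "\<And>ks. (stack_step xs ^^ t') (q # ks, s') = (ks, s'')"
    using assms unfolding runs_def by blast
  show ?thesis
  proof (rule runs_prepend[of xs _ _ "[p, q]" "t' + t"])
    show "(stack_step xs ^^ (t' + t)) ([p, q] @ ks, s) = (ks, s'')" for ks
      by (simp add: funpow_add t)
  qed (use t in \<open>auto simp: stack_step_def\<close>)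
qed

lemma runs_If_Sym:
  assumes "cell xs i (s i) = a \<Longrightarrow> runs xs p s T s'" "cell xs i (s i) \<noteq> a \<Longrightarrow> runs xs q s T s'"
  shows "runs xs (If_Sym i a p q) s (Suc T) s'"
proof -
  define r where "r = (if cell xs i (s i) = a then p else q)"
  have "runs xs r s T s'" using assms by (simp add: r_def)
  then obtain t where "t \<le> T" "\<And>ks. (stack_step xs ^^ t) (r # ks, s) = (ks, s')"
    unfolding runs_def by blast
  then show ?thesis
    by (intro runs_prepend[of xs _ _ "[r]" t]) (auto simp: stack_step_def r_def)
qed

lemma runs_Until_stop: "cell xs i (s i) = a \<Longrightarrow> runs xs (Until i a p) s 1 s"
  unfolding runs_def by (intro exI[of _ 1]) (auto simp: stack_step_def)

lemma runs_Until_step: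
  assumes "cell xs i (s i) \<noteq> a" "runs xs p s T s'" "runs xs (Until i a p) s' T' s''"
  shows "runs xs (Until i a p) s (Suc (T + T')) s''"
proof -
  obtain t t' where t: "t \<le> T" "\<And>ks. (stack_step xs ^^ t) (p # ks, s) = (ks, s')"
    "t' \<le> T'" "\<And>ks. (stack_step xs ^^ t') (Until i a p # ks, s') = (ks, s'')"
    using assms unfolding runs_def by blast
  show ?thesis
  proof (rule runs_prepend[of xs _ _ "[p, Until i a p]" "t' + t"])
    show "(stack_step xs ^^ (t' + t)) ([p, Until i a p] @ ks, s) = (ks, s'')" for ks
      by (simp add: funpow_add t)
  qed (use t assms(1) in \<open>auto simp: stack_step_def\<close>)
qed

text \<open>\<open>f m\<close> is the state with \<open>m\<close> rounds left, so the run goes from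
  \<open>f k\<close> down to \<open>f 0\<close>. Each round pays one step for its test, and the
  failing-to-continue test adds the final 1.\<close>

lemma runs_Until_iterate:
  assumes "\<And>m. m < k \<Longrightarrow> cell xs i (f (Suc m) i) \<noteq> a"
    and "cell xs i (f 0 i) = a"
    and "\<And>m. m < k \<Longrightarrow> runs xs p (f (Suc m)) T (f m)"
  shows "runs xs (Until i a p) (f k) (k * Suc T + 1) (f 0)"
  using assms(1,3)
proof (induction k)
  case 0
  show ?case using runs_Until_stop[of xs i "f 0" a p] assms(2) by simp
next
  case (Suc k)
  then have "runs xs (Until i a p) (f k) (k * Suc T + 1) (f 0)" by simp
  then have "runs xs (Until i a p) (f (Suc k)) (Suc (T + (k * Suc T + 1))) (f 0)"
    by (intro runs_Until_step[of xs i "f (Suc k)" a p T "f k"] Suc.prems) simp_all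
  then show ?case by (rule runs_weaken) simp_all
qed

text \<open>The control states are the stacks that can arise while \<open>p\<close> runs on top of \<open>ks\<close>.\<close>

primrec stacks :: "cmd \<Rightarrow> cmd list \<Rightarrow> cmd list set" where
  "stacks (Move i m) ks = {Move i m # ks}"
| "stacks (p ;; q) ks = insert ((p ;; q) # ks) (stacks p (q # ks) \<union> stacks q ks)"
| "stacks (If_Sym i a p q) ks = insert (If_Sym i a p q # ks) (stacks p ks \<union> stacks q ks)"
| "stacks (Until i a p) ks = insert (Until i a p # ks) (stacks p (Until i a p # ks))"
| "stacks Accept ks = {Accept # ks}"
| "stacks Reject ks = {Reject # ks}"

text \<open>This makes the stack a legitimate finite control. A loop body runs on top of the loop
  itself, so iteration does not deepen the stack.\<close>

lemma finite_stacks: "finite (stacks p ks)"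
  by (induction p arbitrary: ks) auto

lemma Cons_in_stacks: "p # ks \<in> stacks p ks"
  by (cases p) auto

lemma next_stack_in_stacks:
  "st \<in> stacks p ks \<Longrightarrow> next_stack st f \<in> insert ks (stacks p ks)"
proof (induction p arbitrary: ks st)
  case (Seq p q)
  then consider "st = (p ;; q) # ks" | "st \<in> stacks p (q # ks)" | "st \<in> stacks q ks" by auto
  then show ?case
  proof cases
    case 2
    then show ?thesis using Seq.IH(1)[OF 2] Cons_in_stacks[of q ks] by auto
  next
    case 3
    then show ?thesis using Seq.IH(2)[OF 3] by auto
  qed (simp add: Cons_in_stacks)
next
  case (Until i a p)
  then consider "st = Until i a p # ks" | "st \<in> stacks p (Until i a p # ks)" by auto
  then show ?case
  proof cases
    case 2
    then show ?thesis using Until.IH[OF 2] by auto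
  qed (simp add: Cons_in_stacks)
qed (auto simp: Cons_in_stacks)

lemma tapes_of_stacks:
  "\<lbrakk>st \<in> stacks p ks; tapes p \<subseteq> A; \<forall>c\<in>set ks. tapes c \<subseteq> A\<rbrakk> \<Longrightarrow> \<forall>c\<in>set st. tapes c \<subseteq> A"
proof (induction p arbitrary: ks st)
  case (Seq p q)
  then consider "st = (p ;; q) # ks" | "st \<in> stacks p (q # ks)" | "st \<in> stacks q ks" by auto
  then show ?case
  proof cases
    case 1
    then show ?thesis using Seq.prems(2,3) by simp
  next
    case 2
    show ?thesis by (rule Seq.IH(1)[OF 2]) (use Seq.prems(2,3) in simp_all)
  next
    case 3
    show ?thesis by (rule Seq.IH(2)[OF 3]) (use Seq.prems(2,3) in simp_all)
  qed
next
  case (Until i a p)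
  then consider "st = Until i a p # ks" | "st \<in> stacks p (Until i a p # ks)" by auto
  then show ?case
  proof cases
    case 1
    then show ?thesis using Until.prems(2,3) by simp
  next
    case 2
    show ?thesis by (rule Until.IH[OF 2]) (use Until.prems(2,3) in simp_all)
  qed
next
  case (If_Sym i a p q)
  then consider "st = If_Sym i a p q # ks" | "st \<in> stacks p ks" | "st \<in> stacks q ks" by auto
  then show ?case
  proof cases
    case 1
    then show ?thesis using If_Sym.prems(2,3) by simp
  next
    case 2
    show ?thesis by (rule If_Sym.IH(1)[OF 2]) (use If_Sym.prems(2,3) in simp_all)
  next
    case 3
    show ?thesis by (rule If_Sym.IH(2)[OF 3]) (use If_Sym.prems(2,3) in simp_all)
  qed
qed simp_all

text \<open>The symbols under the heads of the tapes that occur in the stack determine the next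
  stack; hence a machine with finitely many tapes can take the step.\<close>

lemma next_stack_cong:
  "\<lbrakk>\<forall>c\<in>set st. tapes c \<subseteq> A; \<And>i. i \<in> A \<Longrightarrow> f i = g i\<rbrakk> \<Longrightarrow> next_stack st f = next_stack st g"
  by (cases "(st, f)" rule: next_stack.cases) auto

section \<open>Command stacks as the states of a Turing machine\<close>

locale stack_machine =
  fixes P :: cmd and K :: nat and code :: "cmd list \<Rightarrow> nat"
  fixes F
  defines "F \<equiv> stacks P [] \<union> {[], [Accept], [Reject]}"
  assumes K: "1 \<le> K" "tapes P \<subseteq> {..<K}"
    and code: "bij_betw code F {..<card F}"
begin

definition decode :: "nat \<Rightarrow> cmd list" where
  "decode = inv_into F code"

text \<open>Each tape writes back the symbol it has read. The stacks added to \<open>F\<close> are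
  what is left when the last command is popped, and the two halting states. Exactly
  \<open>[Accept]\<close> and \<open>[Reject]\<close> halt; with further commands below, the machine
  would loop.\<close>

definition M :: tm where
  "M = \<lparr>num_tapes = K, num_symbols = 4, num_states = card F,
     start_state = code [P], accept_state = code [Accept], reject_state = code [Reject],
     trans = \<lambda>q syms. (code (next_stack (decode q) (\<lambda>i. syms ! i)),
       map (\<lambda>i. (syms ! i, stack_move (decode q) i)) [0..<K])\<rparr>"

definition conf :: "bool list \<Rightarrow> cmd list \<times> (nat \<Rightarrow> nat) \<Rightarrow> config" where
  "conf xs c = (code (fst c), map (\<lambda>i. (cell xs i, snd c i)) [0..<K])"

lemma decode_code: "st \<in> F \<Longrightarrow> decode (code st) = st"
  using code unfolding decode_def by (simp add: bij_betw_def)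

lemma decode_in: "q < card F \<Longrightarrow> decode q \<in> F"
  using code unfolding decode_def bij_betw_def by (metis inv_into_into lessThan_iff)

lemma code_less: "st \<in> F \<Longrightarrow> code st < card F"
  using code bij_betwE by blast

lemma code_eq_iff: "st \<in> F \<Longrightarrow> st' \<in> F \<Longrightarrow> code st = code st' \<longleftrightarrow> st = st'"
  using decode_code by metis

lemma next_stack_in_F: "st \<in> F \<Longrightarrow> next_stack st f \<in> F"
  using next_stack_in_stacks[of st P "[]" f] unfolding F_def by auto

lemma mem_F: "[P] \<in> F" "[] \<in> F" "[Accept] \<in> F" "[Reject] \<in> F"
  by (simp_all add: F_def Cons_in_stacks)

lemma tapes_F: "st \<in> F \<Longrightarrow> \<forall>c\<in>set st. tapes c \<subseteq> {..<K}"
  using tapes_of_stacks[of st P "[]" "{..<K}"] K unfolding F_def by fastforce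

lemma wf: "wf_tm M"
  unfolding wf_tm_def M_def
  using K mem_F
  by (auto simp: code_less code_eq_iff decode_in next_stack_in_F subset_iff)

text \<open>The simulation is step for step, even after halting, since \<open>Accept\<close> and
  \<open>Reject\<close> keep themselves on the stack.\<close>

lemma tm_step_conf:
  assumes "fst c \<in> F"
  shows "tm_step M (conf xs c) = conf xs (stack_step xs c)"
proof -
  obtain st s where c: "c = (st, s)" by (cases c)
  with assms have st: "st \<in> F" by simp
  have read: "map read_tape (snd (conf xs c)) = map (\<lambda>i. cell xs i (s i)) [0..<K]"
    by (simp add: conf_def c read_tape_def)
  show ?thesis
  proof (cases "st = [Accept] \<or> st = [Reject]")
    case True
    then have "halted M (conf xs c)" by (auto simp: halted_def conf_def M_def c)
    moreover have "stack_step xs c = c" using True by (auto simp: stack_step_def c)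
    ultimately show ?thesis by (simp add: tm_step_def)
  next
    case False
    then have "\<not> halted M (conf xs c)"
      using st mem_F by (auto simp: halted_def conf_def M_def c code_eq_iff)
    moreover have "next_stack st (\<lambda>i. map (\<lambda>i. cell xs i (s i)) [0..<K] ! i) =
        next_stack st (\<lambda>i. cell xs i (s i))"
      by (rule next_stack_cong[OF tapes_F[OF st]]) simp
    moreover have "map2 act_on_tape
        (map (\<lambda>i. (map (\<lambda>i. cell xs i (s i)) [0..<K] ! i, stack_move st i)) [0..<K])
        (map (\<lambda>i. (cell xs i, s i)) [0..<K]) =
      map (\<lambda>i. (cell xs i, move_head (stack_move st i) (s i))) [0..<K]"
      by (rule nth_equalityI) (auto simp: act_on_tape_def)
    ultimately show ?thesis
      unfolding tm_step_def read
      by (simp add: conf_def c M_def decode_code[OF st] stack_step_def)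
  qed
qed

lemma init_config_conf: "init_config M xs = conf xs ([P], \<lambda>_. 0)"
proof -
  have "init_tape xs # replicate (K - 1) (init_tape []) = map (\<lambda>i. (cell xs i, 0)) [0..<K]"
    by (rule nth_equalityI) (use K in \<open>auto simp: cell_def nth_Cons' init_tape_def\<close>)
  then show ?thesis by (simp add: init_config_def conf_def M_def)
qed

lemma funpow_tm_step:
  "(tm_step M ^^ t) (init_config M xs) = conf xs ((stack_step xs ^^ t) ([P], \<lambda>_. 0)) \<and>
   fst ((stack_step xs ^^ t) ([P], \<lambda>_. 0)) \<in> F"
proof (induction t)
  case (Suc t)
  have "fst (stack_step xs c) \<in> F" if "fst c \<in> F" for c
    using next_stack_in_F[OF that] by (simp add: stack_step_def)
  with Suc show ?case by (simp add: tm_step_conf)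
qed (simp add: init_config_conf mem_F)

end

text \<open>Tape 4 holds the truth value of the answer: its head is away from cell 0 iff it is yes.\<close>

theorem poly_time_solvable_by_cmd:
  fixes p :: "nat poly"
  assumes "\<And>x. x \<in> I \<Longrightarrow> \<exists>s. runs (enc x) c (\<lambda>_. 0) (poly p (length (enc x))) s \<and> (s 4 \<noteq> 0 \<longleftrightarrow> Q x)"
  shows "poly_time_solvable I enc Q"
proof -
  define P where "P = c ;; If_Sym 4 1 Reject Accept"
  define F where "F = stacks P [] \<union> {[], [Accept], [Reject]}"
  have fin: "finite (tapes c)" for c by (induction c) auto
  then obtain K where K: "tapes P \<subseteq> {..<K}"
    by (metis finite_nat_iff_bounded)
  then have "1 \<le> K" by (auto simp: P_def)
  have "finite F" by (simp add: F_def finite_stacks)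
  then obtain code where "bij_betw code F {..<card F}"
    using ex_bij_betw_finite_nat[of F] by (auto simp: atLeast0LessThan)
  then interpret stack_machine P K code F
    using K \<open>1 \<le> K\<close> by unfold_locales (auto simp: F_def)
  \<comment> \<open>The two additional steps unfold the outer \<open>;;\<close> and perform the
    final test of tape 4.\<close>
  have "\<exists>t\<le>poly (p + [:2:]) (length (enc x)). 
      fst ((tm_step M ^^ t) (init_config M (enc x))) =
      (if Q x then accept_state M else reject_state M)" if x: "x \<in> I" for x
  proof -
    let ?xs = "enc x"
    obtain s t where s: "s 4 \<noteq> 0 \<longleftrightarrow> Q x" and t: "t \<le> poly p (length ?xs)"
      "\<And>ks. (stack_step ?xs ^^ t) (c # ks, \<lambda>_. 0) = (ks, s)"
      using assms[OF x] unfolding runs_def by blast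
    have 4: "cell ?xs 4 (s 4) = 1 \<longleftrightarrow> s 4 = 0" by (simp add: cell_def init_tape_def)
    let ?test = "If_Sym 4 1 Reject Accept" and ?ans = "if Q x then Accept else Reject"
    have "stack_step ?xs ([P], \<lambda>_. 0) = ([c, ?test], \<lambda>_. 0)"
      by (simp add: stack_step_def P_def)
    moreover have "stack_step ?xs ([?test], s) = ([?ans], s)"
      using 4 s by (auto simp: stack_step_def)
    ultimately have "(stack_step ?xs ^^ Suc (Suc t)) ([P], \<lambda>_. 0) = ([?ans], s)"
      using t(2)[of "[?test]"] by (simp add: funpow_swap1)
    then have "fst ((tm_step M ^^ Suc (Suc t)) (init_config M ?xs)) = code [?ans]"
      using funpow_tm_step[of "Suc (Suc t)" ?xs] by (simp add: conf_def del: funpow.simps)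
    moreover have "code [?ans] = (if Q x then accept_state M else reject_state M)"
      by (simp add: M_def)
    moreover have "Suc (Suc t) \<le> poly (p + [:2:]) (length ?xs)" using t(1) by simp
    ultimately show ?thesis by metis
  qed
  then have "(Q x \<longrightarrow> accepts_within M (enc x) (poly (p + [:2:]) (length (enc x)))) \<and>
      (\<not> Q x \<longrightarrow> rejects_within M (enc x) (poly (p + [:2:]) (length (enc x))))" if "x \<in> I" for x
    unfolding accepts_within_def rejects_within_def using that by presburger
  with wf show ?thesis unfolding poly_time_solvable_def by blast
qed

section \<open>Evaluating first-order formulas\<close>

abbreviation inc :: "nat \<Rightarrow> cmd" where "inc i \<equiv> Move i Move_Right"
abbreviation dec :: "nat \<Rightarrow> cmd" where "dec i \<equiv> Move i Move_Left"
abbreviation skip :: cmd where "skip \<equiv> Move 0 Stay"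
abbreviation clear :: "nat \<Rightarrow> cmd" where "clear i \<equiv> Until i 1 (dec i)"

text \<open>A counter can be read only by counting it down, so its value is collected on the scratch
  tape \<open>t\<close> during the loop and poured back afterwards.\<close>

definition repeat_cmd :: "nat \<Rightarrow> nat \<Rightarrow> cmd \<Rightarrow> cmd" where
  "repeat_cmd i t p = Until i 1 (dec i ;; inc t ;; p) ;; Until t 1 (dec t ;; inc i)"

lemma cell_eq_1_iff: "cell xs i p = 1 \<longleftrightarrow> p = 0"
  by (simp add: cell_def init_tape_def bit_symbol_def)

lemma runs_inc: "s' = s(i := s i + 1) \<Longrightarrow> runs xs (inc i) s 1 s'"
  using runs_Move[of xs i Move_Right s] by simp

lemma runs_dec: "s' = s(i := s i - 1) \<Longrightarrow> runs xs (dec i) s 1 s'"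
  using runs_Move[of xs i Move_Left s] by simp

lemma runs_skip: "runs xs skip s 1 s"
  using runs_Move[of xs 0 Stay s] by simp

lemma runs_If_zero:
  assumes "s i = 0 \<Longrightarrow> runs xs p s T s'" "s i \<noteq> 0 \<Longrightarrow> runs xs q s T s'"
  shows "runs xs (If_Sym i 1 p q) s (Suc T) s'"
  by (rule runs_If_Sym; insert assms, unfold cell_eq_1_iff, blast)

lemma runs_countdown:
  assumes "\<And>m. m \<le> k \<Longrightarrow> f m i = m"
    and "\<And>m. m < k \<Longrightarrow> runs xs p (f (Suc m)) T (f m)"
  shows "runs xs (Until i 1 p) (f k) (k * Suc T + 1) (f 0)"
proof (rule runs_Until_iterate)
  show "cell xs i (f (Suc m) i) \<noteq> 1" if "m < k" for m
    using assms(1)[of "Suc m"] that unfolding cell_eq_1_iff by simp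
  show "cell xs i (f 0 i) = 1" using assms(1)[of 0] unfolding cell_eq_1_iff by simp
qed (rule assms(2))

lemma runs_clear: "runs xs (clear i) s (s i * 2 + 1) (s(i := 0))"
proof -
  have "runs xs (clear i) ((\<lambda>m. s(i := m)) (s i)) (s i * Suc 1 + 1) ((\<lambda>m. s(i := m)) 0)"
    by (rule runs_countdown, simp, rule runs_dec) (simp add: fun_eq_iff)
  then show ?thesis by (simp add: mult_2_right)
qed

text \<open>\<open>h m\<close> is the value of counter \<open>j\<close> after \<open>m\<close>
  rounds. The body has to work for arbitrary \<open>a\<close> and \<open>b\<close> because
  \<open>i\<close> and \<open>t\<close> are in motion while it runs. Of the 9 steps per round, 5
  belong to draining \<open>i\<close> and 4 to refilling it.\<close>

lemma runs_repeat:
  assumes "i \<noteq> t" "j \<noteq> i" "j \<noteq> t" "s t = 0" "h 0 = s j"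
    and body: "\<And>a b m. m < s i \<Longrightarrow> runs xs p (s(i := a, t := b, j := h m)) T (s(i := a, t := b, j := h (Suc m)))"
  shows "runs xs (repeat_cmd i t p) s (s i * (T + 9) + 3) (s(j := h (s i)))"
proof -
  let ?k = "s i"
  let ?f = "\<lambda>m. s(i := m, t := ?k - m, j := h (?k - m))"
  let ?g = "\<lambda>m. s(i := ?k - m, t := m, j := h ?k)"
  have "runs xs (dec i ;; inc t ;; p) (?f (Suc m)) (T + 4) (?f m)" if "m < ?k" for m
  proof -
    have "runs xs (dec i) (?f (Suc m)) 1 (s(i := m, t := ?k - Suc m, j := h (?k - Suc m)))"
      by (rule runs_dec) (use assms in \<open>auto simp: fun_eq_iff\<close>)
    moreover have "runs xs (inc t) (s(i := m, t := ?k - Suc m, j := h (?k - Suc m))) 1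
        (s(i := m, t := ?k - m, j := h (?k - Suc m)))"
      by (rule runs_inc) (use assms that in \<open>auto simp: fun_eq_iff\<close>)
    moreover have "runs xs p (s(i := m, t := ?k - m, j := h (?k - Suc m))) T (?f m)"
      using body[of "?k - Suc m" m "?k - m"] that by (simp add: Suc_diff_Suc)
    ultimately have "runs xs (dec i ;; inc t ;; p) (?f (Suc m)) (Suc (1 + Suc (1 + T))) (?f m)"
      by (intro runs_Seq)
    then show ?thesis by (rule runs_weaken) simp_all
  qed
  then have "runs xs (Until i 1 (dec i ;; inc t ;; p)) (?f ?k) (?k * Suc (T + 4) + 1) (?f 0)"
    by (rule runs_countdown[rotated]) (use assms in auto)
  moreover have "?f ?k = s" using assms by (auto simp: fun_eq_iff)
  moreover have "runs xs (Until t 1 (dec t ;; inc i)) (?g ?k) (?k * Suc 3 + 1) (?g 0)"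
  proof (rule runs_countdown)
    show "runs xs (dec t ;; inc i) (?g (Suc m)) 3 (?g m)" if "m < ?k" for m
    proof -
      have "runs xs (dec t) (?g (Suc m)) 1 (s(i := ?k - Suc m, t := m, j := h ?k))"
        by (rule runs_dec) (use assms in \<open>auto simp: fun_eq_iff\<close>)
      moreover have "runs xs (inc i) (s(i := ?k - Suc m, t := m, j := h ?k)) 1 (?g m)"
        by (rule runs_inc) (use assms that in \<open>auto simp: fun_eq_iff\<close>)
      ultimately have "runs xs (dec t ;; inc i) (?g (Suc m)) (Suc (1 + 1)) (?g m)"
        by (rule runs_Seq)
      then show ?thesis by (rule runs_weaken) simp_all
    qed
  qed (use assms in auto)
  moreover have "?f 0 = ?g ?k" "?g 0 = s(j := h ?k)" using assms by (auto simp: fun_eq_iff)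
  ultimately have "runs xs (repeat_cmd i t p) s (Suc (?k * Suc (T + 4) + 1 + (?k * Suc 3 + 1))) (s(j := h ?k))"
    unfolding repeat_cmd_def by (metis runs_Seq)
  then show ?thesis by (rule runs_weaken) (simp_all add: algebra_simps)
qed

lemma runs_add:
  assumes "i \<noteq> t" "j \<noteq> i" "j \<noteq> t" "s t = 0"
  shows "runs xs (repeat_cmd i t (inc j)) s (s i * 10 + 3) (s(j := s j + s i))"
proof -
  have "runs xs (inc j) (s(i := a, t := b, j := s j + m)) 1 (s(i := a, t := b, j := s j + Suc m))" for a b m
    by (rule runs_inc) (simp add: fun_eq_iff)
  then show ?thesis
    using runs_repeat[of i t j s "\<lambda>m. s j + m" xs "inc j" 1] assms by simp
qed

lemma runs_sub:
  assumes "i \<noteq> t" "j \<noteq> i" "j \<noteq> t" "s t = 0"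
  shows "runs xs (repeat_cmd i t (dec j)) s (s i * 10 + 3) (s(j := s j - s i))"
proof -
  have "runs xs (dec j) (s(i := a, t := b, j := s j - m)) 1 (s(i := a, t := b, j := s j - Suc m))" for a b m
    by (rule runs_dec) (simp add: fun_eq_iff)
  then show ?thesis
    using runs_repeat[of i t j s "\<lambda>m. s j - m" xs "dec j" 1] assms by simp
qed

lemma runs_add_mult:
  assumes "distinct [i, i', t, t', j]" "s t = 0" "s t' = 0"
  shows "runs xs (repeat_cmd i t (repeat_cmd i' t' (inc j))) s (s i * (s i' * 10 + 12) + 3)
    (s(j := s j + s i * s i'))"
proof -
  have ne: "i' \<noteq> i" "i' \<noteq> t" "i' \<noteq> t'" "j \<noteq> i'" "j \<noteq> t'" "t' \<noteq> t" "t' \<noteq> i" "t' \<noteq> j"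
    using assms by auto
  have "runs xs (repeat_cmd i' t' (inc j)) (s(i := a, t := b, j := s j + m * s i')) (s i' * 10 + 3)
      (s(i := a, t := b, j := s j + Suc m * s i'))" for a b m
    using runs_add[of i' t' j "s(i := a, t := b, j := s j + m * s i')" xs] assms ne
    by (simp add: algebra_simps)
  then have "runs xs (repeat_cmd i t (repeat_cmd i' t' (inc j))) s (s i * ((s i' * 10 + 3) + 9) + 3)
    (s(j := (\<lambda>m. s j + m * s i') (s i)))"
    by (intro runs_repeat) (use assms in auto)
  then show ?thesis by (rule runs_weaken) simp_all
qed

text \<open>\<open>Exists1\<close> is primitive because conflict-freeness asks for cardinality one.
  The address in \<open>Sym\<close>, with one variable scaled by \<open>n\<close>, reaches every
  matrix entry and, when \<open>w\<close> has the value \<open>n\<close>, the cells behind the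
  matrix. \<open>Leq\<close> serves to express equality.\<close>

datatype fm =
    Sym nat nat nat nat
  | Leq nat nat
  | Neg fm
  | Conj fm fm
  | Exists nat fm
  | Exists1 nat fm

text \<open>\<open>a\<close> is the contents of the input tape, whose cells from \<open>n + 2\<close> on hold the adjacency matrix.\<close>

primrec sem :: "(nat \<Rightarrow> nat) \<Rightarrow> nat \<Rightarrow> (nat \<Rightarrow> nat) \<Rightarrow> fm \<Rightarrow> bool" where
  "sem a n e (Sym c w u b) = (a (c + n + e w * n + e u) = b)"
| "sem a n e (Leq i j) = (e i \<le> e j)"
| "sem a n e (Neg p) = (\<not> sem a n e p)"
| "sem a n e (Conj p q) = (sem a n e p \<and> sem a n e q)"
| "sem a n e (Exists j p) = (\<exists>x<n. sem a n (e(j := x)) p)"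
| "sem a n e (Exists1 j p) = (card {x. x < n \<and> sem a n (e(j := x)) p} = 1)"

primrec bound_vars :: "fm \<Rightarrow> nat set" where
  "bound_vars (Sym c w u b) = {}"
| "bound_vars (Leq i j) = {}"
| "bound_vars (Neg p) = bound_vars p"
| "bound_vars (Conj p q) = bound_vars p \<union> bound_vars q"
| "bound_vars (Exists j p) = insert j (bound_vars p)"
| "bound_vars (Exists1 j p) = insert j (bound_vars p)"

text \<open>A variable owns a single pair of tapes, so a nested quantifier over the same variable
  would overwrite a counter in use. Reuse in parallel subformulas is allowed, as both tapes are back
  at zero by then.\<close>

primrec rebinding_free :: "fm \<Rightarrow> bool" where
  "rebinding_free (Sym c w u b) = True"
| "rebinding_free (Leq i j) = True"
| "rebinding_free (Neg p) = rebinding_free p"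
| "rebinding_free (Conj p q) = (rebinding_free p \<and> rebinding_free q)"
| "rebinding_free (Exists j p) = (j \<notin> bound_vars p \<and> rebinding_free p)"
| "rebinding_free (Exists1 j p) = (j \<notin> bound_vars p \<and> rebinding_free p)"

text \<open>Tape 1 holds \<open>n\<close>, tapes 2 and 3 are scratch, tape 4 is the truth value. While a quantified
  variable \<open>j\<close> counts down from \<open>n\<close> on tape \<open>var j\<close>, tape \<open>ctr j\<close> counts its witnesses.\<close>

definition var :: "nat \<Rightarrow> nat" where "var j = 5 + 2 * j"
definition ctr :: "nat \<Rightarrow> nat" where "ctr j = 6 + 2 * j"

lemma var_ctr_simps [simp]:
  "var i = var j \<longleftrightarrow> i = j" "ctr i = ctr j \<longleftrightarrow> i = j" "var i \<noteq> ctr j" "ctr j \<noteq> var i"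
  "var i \<noteq> 0" "var i \<noteq> 1" "var i \<noteq> Suc 0" "var i \<noteq> 2" "var i \<noteq> 3" "var i \<noteq> 4"
  "ctr i \<noteq> 0" "ctr i \<noteq> 1" "ctr i \<noteq> Suc 0" "ctr i \<noteq> 2" "ctr i \<noteq> 3" "ctr i \<noteq> 4"
  "0 \<noteq> var i" "1 \<noteq> var i" "Suc 0 \<noteq> var i" "2 \<noteq> var i" "3 \<noteq> var i" "4 \<noteq> var i"
  "0 \<noteq> ctr i" "1 \<noteq> ctr i" "Suc 0 \<noteq> ctr i" "2 \<noteq> ctr i" "3 \<noteq> ctr i" "4 \<noteq> ctr i"
  unfolding var_def ctr_def by presburger+

section \<open>Compilation of formulas into commands\<close>

primrec advance :: "nat \<Rightarrow> cmd" where
  "advance 0 = skip"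
| "advance (Suc c) = inc 0 ;; advance c"

lemma runs_advance: "runs xs (advance c) s (2 * c + 1) (s(0 := s 0 + c))"
proof (induction c arbitrary: s)
  case (Suc c)
  have "runs xs (advance (Suc c)) s (Suc (1 + (2 * c + 1))) (s(0 := s 0 + 1, 0 := (s(0 := s 0 + 1)) 0 + c))"
    unfolding advance.simps by (rule runs_Seq[OF runs_inc[OF refl] Suc])
  then show ?case by (rule runs_weaken) (simp_all add: fun_eq_iff)
qed (use runs_skip in simp)

text \<open>The decrement precedes \<open>p\<close>, so the values tried are \<open>n - 1\<close>
  down to 0 and the tape of the variable ends at 0.\<close>

definition tally :: "nat \<Rightarrow> cmd \<Rightarrow> cmd" where
  "tally j p = repeat_cmd 1 2 (inc (var j)) ;;
     Until (var j) 1 (dec (var j) ;; p ;; If_Sym 4 1 skip (dec 4 ;; inc (ctr j)))"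

text \<open>For \<open>Sym\<close> the address is accumulated as the position of the input head
  itself, so the test reads the addressed cell directly. \<open>Leq\<close> asks whether a truncated
  difference vanishes, and \<open>Exists1\<close> whether a nonzero count vanishes after one
  decrement.\<close>

primrec compile :: "fm \<Rightarrow> cmd" where
  "compile (Sym c w u b) = advance c ;; repeat_cmd 1 2 (inc 0) ;;
     repeat_cmd (var w) 3 (repeat_cmd 1 2 (inc 0)) ;; repeat_cmd (var u) 2 (inc 0) ;;
     If_Sym 0 b (inc 4) skip ;; clear 0"
| "compile (Leq i j) = repeat_cmd (var i) 2 (inc 3) ;; repeat_cmd (var j) 2 (dec 3) ;;
     If_Sym 3 1 (inc 4) (clear 3)"
| "compile (Neg p) = compile p ;; If_Sym 4 1 (inc 4) (dec 4)"
| "compile (Conj p q) = compile p ;; If_Sym 4 1 skip (dec 4 ;; compile q)"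
| "compile (Exists j p) = tally j (compile p) ;; If_Sym (ctr j) 1 skip (inc 4 ;; clear (ctr j))"
| "compile (Exists1 j p) = tally j (compile p) ;;
     If_Sym (ctr j) 1 skip (dec (ctr j) ;; If_Sym (ctr j) 1 (inc 4) (clear (ctr j)))"

lemma runs_tally:
  assumes s: "s 1 = n" "s 2 = 0" "s 4 = 0" "s (var j) = 0" "s (ctr j) = 0"
    and body: "\<And>m c. m < n \<Longrightarrow> runs xs p (s(var j := m, ctr j := c)) T (s(var j := m, ctr j := c, 4 := of_bool (Q m)))"
  shows "runs xs (tally j p) s (n * (T + 18) + 5) (s(ctr j := card {x. x < n \<and> Q x}))"
proof -
  \<comment> \<open>Values are tried in descending order, so at value \<open>m\<close> the witnesses
    counted are those from \<open>m\<close> on.\<close>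
  define N where "N m = card {x. m \<le> x \<and> x < n \<and> Q x}" for m
  let ?f = "\<lambda>m. s(var j := m, ctr j := N m)"
  have "runs xs (dec (var j) ;; p ;; If_Sym 4 1 skip (dec 4 ;; inc (ctr j))) (?f (Suc m)) (T + 7) (?f m)"
    if "m < n" for m
  proof -
    let ?s = "s(var j := m, ctr j := N (Suc m))"
    have "{x. m \<le> x \<and> x < n \<and> Q x} =
        (if Q m then insert m {x. Suc m \<le> x \<and> x < n \<and> Q x} else {x. Suc m \<le> x \<and> x < n \<and> Q x})"
      using that by (auto simp: Suc_le_eq le_less)
    then have N: "N m = N (Suc m) + of_bool (Q m)" by (simp add: N_def)
    have "runs xs (dec (var j)) (?f (Suc m)) 1 ?s"
      by (rule runs_dec) (auto simp: fun_eq_iff)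
    moreover have "runs xs p ?s T (?s(4 := of_bool (Q m)))"
      by (rule body[OF that])
    moreover have "runs xs (If_Sym 4 1 skip (dec 4 ;; inc (ctr j))) (?s(4 := of_bool (Q m))) (Suc 3) (?f m)"
    proof (rule runs_If_zero)
      assume "(?s(4 := of_bool (Q m))) 4 = 0"
      then have "?s(4 := of_bool (Q m)) = ?f m"
        unfolding N using s by (auto simp: fun_eq_iff)
      then show "runs xs skip (?s(4 := of_bool (Q m))) 3 (?f m)"
        by (intro runs_weaken[OF runs_skip]) simp
    next
      assume "(?s(4 := of_bool (Q m))) 4 \<noteq> 0"
      then have "Q m" by (cases "Q m") simp_all
      have "runs xs (dec 4) (?s(4 := of_bool (Q m))) 1 ?s"
        by (rule runs_dec) (use s \<open>Q m\<close> in \<open>auto simp: fun_eq_iff\<close>)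
      moreover have "runs xs (inc (ctr j)) ?s 1 (?f m)"
        by (rule runs_inc) (use N \<open>Q m\<close> in \<open>auto simp: fun_eq_iff\<close>)
      ultimately have "runs xs (dec 4 ;; inc (ctr j)) (?s(4 := of_bool (Q m))) (Suc (1 + 1)) (?f m)"
        by (rule runs_Seq)
      then show "runs xs (dec 4 ;; inc (ctr j)) (?s(4 := of_bool (Q m))) 3 (?f m)"
        by (rule runs_weaken) simp_all
    qed
    ultimately have "runs xs (dec (var j) ;; p ;; If_Sym 4 1 skip (dec 4 ;; inc (ctr j)))
        (?f (Suc m)) (Suc (1 + Suc (T + Suc 3))) (?f m)"
      by (intro runs_Seq)
    then show ?thesis by (rule runs_weaken) simp_all
  qed
  then have "runs xs (Until (var j) 1 (dec (var j) ;; p ;; If_Sym 4 1 skip (dec 4 ;; inc (ctr j))))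
      (?f n) (n * Suc (T + 7) + 1) (?f 0)"
    by (rule runs_countdown[rotated]) simp_all
  moreover have "runs xs (repeat_cmd 1 2 (inc (var j))) s (n * 10 + 3) (?f n)"
  proof -
    have "N n = 0" by (simp add: N_def)
    then have "?f n = s(var j := n)" using s by (auto simp: fun_eq_iff)
    then show ?thesis using runs_add[of 1 2 "var j" s xs] s by simp
  qed
  ultimately have "runs xs (tally j p) s (Suc ((n * 10 + 3) + (n * Suc (T + 7) + 1))) (?f 0)"
    unfolding tally_def by (intro runs_Seq)
  then show ?thesis
    by (rule runs_weaken) (use s in \<open>auto simp: fun_eq_iff N_def algebra_simps\<close>)
qed

section \<open>Correctness and polynomial running time of compiled formulas\<close>

definition poly_bounded :: "(nat \<Rightarrow> nat) \<Rightarrow> bool" where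
  "poly_bounded f \<longleftrightarrow> (\<exists>p. \<forall>x. f x \<le> poly p x)"

lemma poly_bounded_const: "poly_bounded (\<lambda>x. c)"
  unfolding poly_bounded_def by (intro exI[of _ "[:c:]"]) simp

lemma poly_bounded_id: "poly_bounded (\<lambda>x. x)"
  unfolding poly_bounded_def by (intro exI[of _ "[:0, 1:]"]) simp

lemma poly_bounded_add: "poly_bounded f \<Longrightarrow> poly_bounded g \<Longrightarrow> poly_bounded (\<lambda>x. f x + g x)"
  unfolding poly_bounded_def by (metis add_mono poly_add)

lemma poly_bounded_mult: "poly_bounded f \<Longrightarrow> poly_bounded g \<Longrightarrow> poly_bounded (\<lambda>x. f x * g x)"
  unfolding poly_bounded_def by (metis mult_le_mono poly_mult)

lemmas poly_bounded_intros = poly_bounded_const poly_bounded_id poly_bounded_add poly_bounded_mult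

text \<open>Variables may reach \<open>n\<close> itself, although quantifiers range below
  \<open>n\<close>: variable 0 is preset to \<open>n\<close>.\<close>

definition ready :: "nat \<Rightarrow> nat set \<Rightarrow> (nat \<Rightarrow> nat) \<Rightarrow> bool" where
  "ready n B s \<longleftrightarrow> s 0 = 0 \<and> s 1 = n \<and> s 2 = 0 \<and> s 3 = 0 \<and> s 4 = 0 \<and>
     (\<forall>j\<in>B. s (var j) = 0 \<and> s (ctr j) = 0) \<and> (\<forall>j. s (var j) \<le> n)"

text \<open>The bound depends on \<open>n\<close> alone, and every head except that of tape 4
  returns to its place, so the state is \<open>ready\<close> again as soon as tape 4 is
  reset.\<close>

definition decides_within :: "cmd \<Rightarrow> fm \<Rightarrow> (nat \<Rightarrow> nat) \<Rightarrow> bool" where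
  "decides_within p \<phi> f \<longleftrightarrow> (\<forall>xs n s. ready n (bound_vars \<phi>) s \<longrightarrow>
     runs xs p s (f n) (s(4 := of_bool (sem (cell xs 0) n (\<lambda>j. s (var j)) \<phi>))))"

lemma decides_Sym: "decides_within (compile (Sym c w u b)) (Sym c w u b)
   (\<lambda>n. 2 * c + n * 40 + n * (n * 10 + 12) + 2 * (c + n + n * n + n) + 30)"
  unfolding decides_within_def
proof (intro allI impI)
  fix xs n s
  assume "ready n (bound_vars (Sym c w u b)) s"
  then have s: "s 0 = 0" "s 1 = n" "s 2 = 0" "s 3 = 0" "s 4 = 0" "s (var w) \<le> n" "s (var u) \<le> n"
    by (simp_all add: ready_def)
  define h where "h = c + n + s (var w) * n + s (var u)"
  let ?r = "of_bool (cell xs 0 h = b)"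
  have s1: "s (Suc 0) = n" using s(2) by simp
  have "runs xs (advance c) s (2 * c + 1) (s(0 := c))"
    using runs_advance[of xs c s] s by simp
  moreover have "runs xs (repeat_cmd 1 2 (inc 0)) (s(0 := c)) (n * 10 + 3) (s(0 := c + n))"
    using runs_add[of 1 2 0 "s(0 := c)" xs] s by simp
  moreover have "runs xs (repeat_cmd (var w) 3 (repeat_cmd 1 2 (inc 0))) (s(0 := c + n))
      (s (var w) * (n * 10 + 12) + 3) (s(0 := c + n + s (var w) * n))"
    using runs_add_mult[of "var w" 1 3 2 0 "s(0 := c + n)" xs] s s1 by simp
  moreover have "runs xs (repeat_cmd (var u) 2 (inc 0)) (s(0 := c + n + s (var w) * n))
      (s (var u) * 10 + 3) (s(0 := h))"
    using runs_add[of "var u" 2 0 "s(0 := c + n + s (var w) * n)" xs] s by (simp add: h_def)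
  moreover have "runs xs (If_Sym 0 b (inc 4) skip) (s(0 := h)) (Suc 1) (s(0 := h, 4 := ?r))"
  proof (rule runs_If_Sym)
    assume "cell xs 0 ((s(0 := h)) 0) = b"
    then show "runs xs (inc 4) (s(0 := h)) 1 (s(0 := h, 4 := ?r))"
      by (intro runs_inc) (simp add: s fun_eq_iff)
  next
    assume "cell xs 0 ((s(0 := h)) 0) \<noteq> b"
    then have "s(0 := h, 4 := ?r) = s(0 := h)" by (simp add: s fun_eq_iff)
    then show "runs xs skip (s(0 := h)) 1 (s(0 := h, 4 := ?r))" using runs_skip by metis
  qed
  moreover have "runs xs (clear 0) (s(0 := h, 4 := ?r)) (h * 2 + 1) (s(4 := ?r))"
  proof -
    have "s(0 := h, 4 := ?r, 0 := 0) = s(4 := ?r)" using s by (simp add: fun_eq_iff)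
    then show ?thesis using runs_clear[of xs 0 "s(0 := h, 4 := ?r)"] by simp
  qed
  ultimately have R: "runs xs (compile (Sym c w u b)) s
     (Suc (2 * c + 1 + Suc (n * 10 + 3 + Suc (s (var w) * (n * 10 + 12) + 3 + Suc (s (var u) * 10 + 3
        + Suc (Suc 1 + (h * 2 + 1))))))) (s(4 := ?r))"
    unfolding compile.simps by (intro runs_Seq)
  have le: "s (var w) * (n * 10 + 12) \<le> n * (n * 10 + 12)" "s (var w) * n \<le> n * n"
    using s by (auto intro: mult_le_mono)
  show "runs xs (compile (Sym c w u b)) s
     (2 * c + n * 40 + n * (n * 10 + 12) + 2 * (c + n + n * n + n) + 30)
     (s(4 := of_bool (sem (cell xs 0) n (\<lambda>j. s (var j)) (Sym c w u b))))"
  proof (rule runs_weaken[OF R])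
    \<comment> \<open>With the products replaced by variables, the comparison becomes
      linear.\<close>
    have arith: "Suc (2 * c + 1 + Suc (n * 10 + 3 + Suc (x + 3 + Suc (y * 10 + 3
        + Suc (Suc 1 + ((c + n + z + y) * 2 + 1)))))) \<le> 2 * c + n * 40 + x' + 2 * (c + n + z' + n) + 30"
      if "y \<le> n" "x \<le> x'" "z \<le> z'" for x y z x' z' using that by simp
    show "Suc (2 * c + 1 + Suc (n * 10 + 3 + Suc (s (var w) * (n * 10 + 12) + 3 + Suc (s (var u) * 10 + 3
        + Suc (Suc 1 + (h * 2 + 1))))))
      \<le> 2 * c + n * 40 + n * (n * 10 + 12) + 2 * (c + n + n * n + n) + 30"
      unfolding h_def by (rule arith[OF s(7) le])
  qed (simp add: h_def)
qed

lemma decides_Leq: "decides_within (compile (Leq i j)) (Leq i j) (\<lambda>n. n * 30 + 20)"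
  unfolding decides_within_def
proof (intro allI impI)
  fix xs n s
  assume "ready n (bound_vars (Leq i j)) s"
  then have s: "s 2 = 0" "s 3 = 0" "s 4 = 0" "s (var i) \<le> n" "s (var j) \<le> n"
    by (simp_all add: ready_def)
  let ?a = "s (var i)" and ?b = "s (var j)"
  let ?r = "of_bool (?a \<le> ?b)"
  have "runs xs (repeat_cmd (var i) 2 (inc 3)) s (?a * 10 + 3) (s(3 := ?a))"
    using runs_add[of "var i" 2 3 s xs] s by simp
  moreover have "runs xs (repeat_cmd (var j) 2 (dec 3)) (s(3 := ?a)) (?b * 10 + 3) (s(3 := ?a - ?b))"
    using runs_sub[of "var j" 2 3 "s(3 := ?a)" xs] s by simp
  moreover have "runs xs (If_Sym 3 1 (inc 4) (clear 3)) (s(3 := ?a - ?b)) (Suc (?a * 2 + 1)) (s(4 := ?r))"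
  proof (rule runs_If_zero)
    assume *: "(s(3 := ?a - ?b)) 3 = 0"
    have "runs xs (inc 4) (s(3 := ?a - ?b)) 1 (s(4 := ?r))"
      by (rule runs_inc) (use * s in \<open>simp add: fun_eq_iff\<close>)
    then show "runs xs (inc 4) (s(3 := ?a - ?b)) (?a * 2 + 1) (s(4 := ?r))"
      by (rule runs_weaken) simp_all
  next
    assume *: "(s(3 := ?a - ?b)) 3 \<noteq> 0"
    show "runs xs (clear 3) (s(3 := ?a - ?b)) (?a * 2 + 1) (s(4 := ?r))"
      by (rule runs_weaken[OF runs_clear]) (use * s in \<open>auto simp: fun_eq_iff\<close>)
  qed
  ultimately have "runs xs (compile (Leq i j)) s
     (Suc (?a * 10 + 3 + Suc (?b * 10 + 3 + Suc (?a * 2 + 1)))) (s(4 := ?r))"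
    unfolding compile.simps by (intro runs_Seq)
  then show "runs xs (compile (Leq i j)) s (n * 30 + 20)
     (s(4 := of_bool (sem (cell xs 0) n (\<lambda>j. s (var j)) (Leq i j))))"
    using s by (elim runs_weaken) simp_all
qed

lemma decides_Neg:
  assumes "decides_within (compile p) p f"
  shows "decides_within (compile (Neg p)) (Neg p) (\<lambda>n. f n + 3)"
  unfolding decides_within_def
proof (intro allI impI)
  fix xs :: "bool list" and n s
  assume r: "ready n (bound_vars (Neg p)) s"
  let ?b = "sem (cell xs 0) n (\<lambda>j. s (var j)) p"
  have "s 4 = 0" using r by (simp add: ready_def)
  have "runs xs (compile p) s (f n) (s(4 := of_bool ?b))"
    using assms r by (simp add: decides_within_def)
  moreover have "runs xs (If_Sym 4 1 (inc 4) (dec 4)) (s(4 := of_bool ?b)) (Suc 1) (s(4 := of_bool (\<not> ?b)))"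
    by (rule runs_If_zero; (rule runs_inc | rule runs_dec)) (auto simp: fun_eq_iff)
  ultimately have "runs xs (compile (Neg p)) s (Suc (f n + Suc 1)) (s(4 := of_bool (\<not> ?b)))"
    unfolding compile.simps by (rule runs_Seq)
  then show "runs xs (compile (Neg p)) s (f n + 3)
     (s(4 := of_bool (sem (cell xs 0) n (\<lambda>j. s (var j)) (Neg p))))"
    by (rule runs_weaken) simp_all
qed

lemma decides_Conj:
  assumes "decides_within (compile p) p f" "decides_within (compile q) q g"
  shows "decides_within (compile (Conj p q)) (Conj p q) (\<lambda>n. f n + g n + 5)"
  unfolding decides_within_def
proof (intro allI impI)
  fix xs :: "bool list" and n s
  assume r: "ready n (bound_vars (Conj p q)) s"
  let ?b = "sem (cell xs 0) n (\<lambda>j. s (var j)) p" and ?c = "sem (cell xs 0) n (\<lambda>j. s (var j)) q"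
  have s4: "s 4 = 0" and rp: "ready n (bound_vars p) s" and rq: "ready n (bound_vars q) s"
    using r by (simp_all add: ready_def)
  have "runs xs (compile p) s (f n) (s(4 := of_bool ?b))"
    using assms(1) rp unfolding decides_within_def by blast
  moreover have "runs xs (If_Sym 4 1 skip (dec 4 ;; compile q)) (s(4 := of_bool ?b)) (Suc (g n + 2))
      (s(4 := of_bool (?b \<and> ?c)))"
  proof (rule runs_If_zero)
    assume "(s(4 := of_bool ?b)) 4 = 0"
    then have "\<not> ?b" by (cases ?b) simp_all
    then show "runs xs skip (s(4 := of_bool ?b)) (g n + 2) (s(4 := of_bool (?b \<and> ?c)))"
      using s4 by (intro runs_weaken[OF runs_skip]) simp_all
  next
    assume "(s(4 := of_bool ?b)) 4 \<noteq> 0"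
    then have b: "?b" by (cases ?b) simp_all
    have "runs xs (dec 4) (s(4 := of_bool ?b)) 1 s"
      by (rule runs_dec) (use b s4 in \<open>simp add: fun_eq_iff\<close>)
    moreover have "runs xs (compile q) s (g n) (s(4 := of_bool ?c))"
      using assms(2) rq unfolding decides_within_def by blast
    ultimately have "runs xs (dec 4 ;; compile q) (s(4 := of_bool ?b)) (Suc (1 + g n)) (s(4 := of_bool ?c))"
      by (rule runs_Seq)
    then show "runs xs (dec 4 ;; compile q) (s(4 := of_bool ?b)) (g n + 2) (s(4 := of_bool (?b \<and> ?c)))"
      by (rule runs_weaken) (use b in simp_all)
  qed
  ultimately have "runs xs (compile (Conj p q)) s (Suc (f n + Suc (g n + 2))) (s(4 := of_bool (?b \<and> ?c)))"
    unfolding compile.simps by (rule runs_Seq)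
  then show "runs xs (compile (Conj p q)) s (f n + g n + 5)
     (s(4 := of_bool (sem (cell xs 0) n (\<lambda>j. s (var j)) (Conj p q))))"
    by (rule runs_weaken) simp_all
qed

lemma runs_tally_compile:
  assumes p: "decides_within (compile p) p f" and j: "j \<notin> bound_vars p"
    and r: "ready n (insert j (bound_vars p)) s"
  shows "runs xs (tally j (compile p)) s (n * (f n + 18) + 5)
    (s(ctr j := card {x. x < n \<and> sem (cell xs 0) n ((\<lambda>j. s (var j))(j := x)) p}))"
proof (rule runs_tally)
  show "s 1 = n" "s 2 = 0" "s 4 = 0" "s (var j) = 0" "s (ctr j) = 0"
    using r by (simp_all add: ready_def)
  fix m c assume "m < n"
  let ?s = "s(var j := m, ctr j := c)"
  \<comment> \<open>Since \<open>j\<close> is not bound inside \<open>p\<close>, its two occupied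
    tapes are not among those that must be zero.\<close>
  have "ready n (bound_vars p) ?s"
    using r j \<open>m < n\<close> unfolding ready_def by auto
  moreover have "(\<lambda>i. ?s (var i)) = (\<lambda>j. s (var j))(j := m)" by auto
  ultimately show "runs xs (compile p) ?s (f n)
      (?s(4 := of_bool (sem (cell xs 0) n ((\<lambda>j. s (var j))(j := m)) p)))"
    using p unfolding decides_within_def by metis
qed

lemma card_below: "card {x. x < n \<and> P x} \<le> (n::nat)"
  using card_mono[of "{..<n}" "{x. x < n \<and> P x}"] by auto

lemma decides_Exists:
  assumes p: "decides_within (compile p) p f" and j: "j \<notin> bound_vars p"
  shows "decides_within (compile (Exists j p)) (Exists j p) (\<lambda>n. n * (f n + 20) + 10)"
  unfolding decides_within_def
proof (intro allI impI)
  fix xs :: "bool list" and n s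
  assume r: "ready n (bound_vars (Exists j p)) s"
  define S where "S = {x. x < n \<and> sem (cell xs 0) n ((\<lambda>j. s (var j))(j := x)) p}"
  let ?b = "sem (cell xs 0) n (\<lambda>j. s (var j)) (Exists j p)"
  have s: "s 4 = 0" "s (ctr j) = 0" using r by (simp_all add: ready_def)
  have S: "card S \<le> n" "card S \<noteq> 0 \<longleftrightarrow> ?b" using card_below by (auto simp: S_def)
  have "runs xs (tally j (compile p)) s (n * (f n + 18) + 5) (s(ctr j := card S))"
    using runs_tally_compile[OF p j] r by (simp add: S_def)
  moreover have "runs xs (If_Sym (ctr j) 1 skip (inc 4 ;; clear (ctr j))) (s(ctr j := card S))
      (Suc (n * 2 + 3)) (s(4 := of_bool ?b))"
  proof (rule runs_If_zero)
    assume "(s(ctr j := card S)) (ctr j) = 0"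
    then have "s(4 := of_bool ?b) = s(ctr j := card S)" using S s by (simp add: fun_eq_iff)
    then show "runs xs skip (s(ctr j := card S)) (n * 2 + 3) (s(4 := of_bool ?b))"
      by (intro runs_weaken[OF runs_skip]) simp_all
  next
    assume *: "(s(ctr j := card S)) (ctr j) \<noteq> 0"
    have "runs xs (inc 4) (s(ctr j := card S)) 1 (s(ctr j := card S, 4 := 1))"
      by (rule runs_inc) (use s in simp)
    moreover have "runs xs (clear (ctr j)) (s(ctr j := card S, 4 := 1)) (card S * 2 + 1) (s(4 := of_bool ?b))"
      by (rule runs_weaken[OF runs_clear]) (use * S s in \<open>auto simp: fun_eq_iff\<close>)
    ultimately have "runs xs (inc 4 ;; clear (ctr j)) (s(ctr j := card S)) (Suc (1 + (card S * 2 + 1)))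
        (s(4 := of_bool ?b))" by (rule runs_Seq)
    then show "runs xs (inc 4 ;; clear (ctr j)) (s(ctr j := card S)) (n * 2 + 3) (s(4 := of_bool ?b))"
      by (rule runs_weaken) (use S in simp_all)
  qed
  ultimately have "runs xs (compile (Exists j p)) s (Suc (n * (f n + 18) + 5 + Suc (n * 2 + 3))) (s(4 := of_bool ?b))"
    unfolding compile.simps by (rule runs_Seq)
  then show "runs xs (compile (Exists j p)) s (n * (f n + 20) + 10) (s(4 := of_bool ?b))"
    by (rule runs_weaken) (simp_all add: algebra_simps)
qed

lemma decides_Exists1:
  assumes p: "decides_within (compile p) p f" and j: "j \<notin> bound_vars p"
  shows "decides_within (compile (Exists1 j p)) (Exists1 j p) (\<lambda>n. n * (f n + 20) + 12)"
  unfolding decides_within_def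
proof (intro allI impI)
  fix xs :: "bool list" and n s
  assume r: "ready n (bound_vars (Exists1 j p)) s"
  define S where "S = {x. x < n \<and> sem (cell xs 0) n ((\<lambda>j. s (var j))(j := x)) p}"
  let ?b = "sem (cell xs 0) n (\<lambda>j. s (var j)) (Exists1 j p)"
  have s: "s 4 = 0" "s (ctr j) = 0" using r by (simp_all add: ready_def)
  have S: "card S \<le> n" "card S = 1 \<longleftrightarrow> ?b" using card_below by (auto simp: S_def)
  have "runs xs (tally j (compile p)) s (n * (f n + 18) + 5) (s(ctr j := card S))"
    using runs_tally_compile[OF p j] r by (simp add: S_def)
  moreover have "runs xs (If_Sym (ctr j) 1 skip (dec (ctr j) ;; If_Sym (ctr j) 1 (inc 4) (clear (ctr j))))
      (s(ctr j := card S)) (Suc (n * 2 + 4)) (s(4 := of_bool ?b))"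
  proof (rule runs_If_zero)
    assume "(s(ctr j := card S)) (ctr j) = 0"
    then have "s(4 := of_bool ?b) = s(ctr j := card S)" 
      unfolding S(2)[symmetric] using s by (simp add: fun_eq_iff)
    then show "runs xs skip (s(ctr j := card S)) (n * 2 + 4) (s(4 := of_bool ?b))"
      by (intro runs_weaken[OF runs_skip]) simp_all
  next
    assume *: "(s(ctr j := card S)) (ctr j) \<noteq> 0"
    let ?s = "s(ctr j := card S - 1)"
    have "runs xs (dec (ctr j)) (s(ctr j := card S)) 1 ?s"
      by (rule runs_dec) simp
    moreover have "runs xs (If_Sym (ctr j) 1 (inc 4) (clear (ctr j))) ?s (Suc (n * 2 + 1)) (s(4 := of_bool ?b))"
    proof (rule runs_If_zero)
      assume "?s (ctr j) = 0"
      with * have "card S = 1" by simp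
      have "runs xs (inc 4) ?s 1 (s(4 := of_bool ?b))"
        by (rule runs_inc, unfold S(2)[symmetric])
          (use \<open>card S = 1\<close> s in \<open>auto simp: fun_eq_iff\<close>)
      then show "runs xs (inc 4) ?s (n * 2 + 1) (s(4 := of_bool ?b))"
        by (rule runs_weaken) simp_all
    next
      assume "?s (ctr j) \<noteq> 0"
      then have "card S \<noteq> 1" by simp
      then have "?s(ctr j := 0) = s(4 := of_bool ?b)"
        unfolding S(2)[symmetric] using s by (simp add: fun_eq_iff)
      moreover have "?s (ctr j) * 2 + 1 \<le> n * 2 + 1" using S(1) by simp
      ultimately show "runs xs (clear (ctr j)) ?s (n * 2 + 1) (s(4 := of_bool ?b))"
        by (intro runs_weaken[OF runs_clear])
    qed
    ultimately have "runs xs (dec (ctr j) ;; If_Sym (ctr j) 1 (inc 4) (clear (ctr j))) (s(ctr j := card S))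
        (Suc (1 + Suc (n * 2 + 1))) (s(4 := of_bool ?b))" by (rule runs_Seq)
    then show "runs xs (dec (ctr j) ;; If_Sym (ctr j) 1 (inc 4) (clear (ctr j))) (s(ctr j := card S))
        (n * 2 + 4) (s(4 := of_bool ?b))" by (rule runs_weaken) simp_all
  qed
  ultimately have "runs xs (compile (Exists1 j p)) s (Suc (n * (f n + 18) + 5 + Suc (n * 2 + 4))) (s(4 := of_bool ?b))"
    unfolding compile.simps by (rule runs_Seq)
  then show "runs xs (compile (Exists1 j p)) s (n * (f n + 20) + 12) (s(4 := of_bool ?b))"
    by (rule runs_weaken) (simp_all add: algebra_simps)
qed

text \<open>A quantifier costs a factor of about \<open>n\<close>. The formula is fixed, so its
  quantifier depth only affects the degree of the polynomial.\<close>

lemma decides_compile: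
  "rebinding_free p \<Longrightarrow> \<exists>f. poly_bounded f \<and> decides_within (compile p) p f"
proof (induction p)
  case (Sym c w u b)
  show ?case by (rule exI, rule conjI[rotated], rule decides_Sym) (intro poly_bounded_intros)
next
  case (Leq i j)
  show ?case by (rule exI, rule conjI[rotated], rule decides_Leq) (intro poly_bounded_intros)
next
  case (Neg p)
  then obtain f where "poly_bounded f" "decides_within (compile p) p f" by auto
  then show ?case
    by (intro exI[of _ "\<lambda>n. f n + 3"] conjI decides_Neg poly_bounded_intros)
next
  case (Conj p q)
  then obtain f g where "poly_bounded f" "decides_within (compile p) p f"
    "poly_bounded g" "decides_within (compile q) q g" by auto
  then show ?case
    by (intro exI[of _ "\<lambda>n. f n + g n + 5"] conjI decides_Conj poly_bounded_intros)
next
  case (Exists j p)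
  then obtain f where "poly_bounded f" "decides_within (compile p) p f" by auto
  with Exists.prems show ?case
    by (intro exI[of _ "\<lambda>n. n * (f n + 20) + 10"] conjI decides_Exists poly_bounded_intros) simp_all
next
  case (Exists1 j p)
  then obtain f where "poly_bounded f" "decides_within (compile p) p f" by auto
  with Exists1.prems show ?case
    by (intro exI[of _ "\<lambda>n. n * (f n + 20) + 12"] conjI decides_Exists1 poly_bounded_intros) simp_all
qed

text \<open>The first move skips the left-end mark; symbol 2 is the zero bit that closes the unary
  prefix. \<open>n\<close> is stored twice: tape 1 drives the loops, and the tape of variable 0
  makes \<open>n\<close> available as an address inside formulas.\<close>

definition read_size :: cmd where
  "read_size = inc 0 ;; Until 0 2 (inc 0 ;; inc 1 ;; inc (var 0)) ;; clear 0"

lemma runs_read_size: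
  assumes "xs = replicate n True @ False # ys"
  shows "runs xs read_size (\<lambda>_. 0) (n * 8 + 10) ((\<lambda>_. 0)(1 := n, var 0 := n))"
proof -
  have cell: "cell xs 0 (Suc m) = (if m < n then 3 else 2)" if "m \<le> n" for m
    using that by (auto simp: cell_def init_tape_def assms bit_symbol_def nth_append)
  let ?f = "\<lambda>m. (\<lambda>_. 0)(0 := Suc (n - m), 1 := n - m, var 0 := n - m)"
  have "runs xs (Until 0 2 (inc 0 ;; inc 1 ;; inc (var 0))) (?f n) (n * Suc 5 + 1) (?f 0)"
  proof (rule runs_Until_iterate)
    show "cell xs 0 (?f (Suc m) 0) \<noteq> 2" if "m < n" for m
      using cell[of "n - Suc m"] that by simp
    show "cell xs 0 (?f 0 0) = 2" using cell[of n] by simp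
    show "runs xs (inc 0 ;; inc 1 ;; inc (var 0)) (?f (Suc m)) 5 (?f m)" if "m < n" for m
    proof -
      let ?k = "n - Suc m"
      have "n - m = Suc ?k" using that by simp
      then have "runs xs (inc 0) (?f (Suc m)) 1 ((\<lambda>_. 0)(0 := Suc (n - m), 1 := ?k, var 0 := ?k))"
        by (intro runs_inc) (simp add: fun_eq_iff)
      moreover have "runs xs (inc 1) ((\<lambda>_. 0)(0 := Suc (n - m), 1 := ?k, var 0 := ?k)) 1
          ((\<lambda>_. 0)(0 := Suc (n - m), 1 := n - m, var 0 := ?k))"
        using \<open>n - m = Suc ?k\<close> by (intro runs_inc) (simp add: fun_eq_iff)
      moreover have "runs xs (inc (var 0)) ((\<lambda>_. 0)(0 := Suc (n - m), 1 := n - m, var 0 := ?k)) 1 (?f m)"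
        using \<open>n - m = Suc ?k\<close> by (intro runs_inc) (simp add: fun_eq_iff)
      ultimately have "runs xs (inc 0 ;; inc 1 ;; inc (var 0)) (?f (Suc m)) (Suc (1 + Suc (1 + 1))) (?f m)"
        by (intro runs_Seq)
      then show ?thesis by (rule runs_weaken) simp_all
    qed
  qed
  moreover have "runs xs (inc 0) (\<lambda>_. 0) 1 (?f n)"
    by (rule runs_inc) (simp add: fun_eq_iff)
  moreover have "runs xs (clear 0) (?f 0) (Suc n * 2 + 1) ((\<lambda>_. 0)(1 := n, var 0 := n))"
    by (rule runs_weaken[OF runs_clear]) (simp_all add: fun_eq_iff)
  ultimately have "runs xs read_size (\<lambda>_. 0) (Suc (1 + Suc (n * Suc 5 + 1 + (Suc n * 2 + 1))))
      ((\<lambda>_. 0)(1 := n, var 0 := n))"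
    unfolding read_size_def by (intro runs_Seq)
  then show ?thesis by (rule runs_weaken) simp_all
qed

lemma poly_mono_nat:
  fixes p :: "nat poly"
  shows "x \<le> y \<Longrightarrow> poly p x \<le> poly p y"
  by (induction p) (auto intro: add_mono mult_mono)

theorem poly_time_solvable_by_fm:
  assumes "rebinding_free \<phi>" "0 \<notin> bound_vars \<phi>"
    and "\<And>x. x \<in> I \<Longrightarrow> \<exists>n ys. enc x = replicate n True @ False # ys \<and>
      (sem (cell (enc x) 0) n ((\<lambda>_. 0)(0 := n)) \<phi> \<longleftrightarrow> Q x)"
  shows "poly_time_solvable I enc Q"
proof -
  obtain f p where f: "decides_within (compile \<phi>) \<phi> f" and p: "\<And>n. f n \<le> poly p n"
    using decides_compile[OF assms(1)] unfolding poly_bounded_def by blast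
  show ?thesis
  \<comment> \<open>The added polynomial is the \<open>n * 8 + 10\<close> steps of
    \<open>read_size\<close> and one for unfolding \<open>;;\<close>. Thanks to the unary prefix,
    \<open>n\<close> is at most the input length, at which it is evaluated.\<close>
  proof (rule poly_time_solvable_by_cmd[where c = "read_size ;; compile \<phi>" and p = "p + [:11, 8:]"])
    fix x assume "x \<in> I"
    then obtain n ys where x: "enc x = replicate n True @ False # ys"
      and Q: "sem (cell (enc x) 0) n ((\<lambda>_. 0)(0 := n)) \<phi> \<longleftrightarrow> Q x" using assms(3) by blast
    let ?s = "(\<lambda>_. 0)(1 := n, var 0 := n) :: nat \<Rightarrow> nat"
    have n: "n \<le> length (enc x)" by (simp add: x)
    \<comment> \<open>The tape of variable 0 already holds \<open>n\<close>, so no quantifier may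
      bind that variable.\<close>
    have r: "ready n (bound_vars \<phi>) ?s" using assms(2) by (auto simp: ready_def)
    have e: "(\<lambda>j. ?s (var j)) = (\<lambda>_. 0)(0 := n)" by (auto simp: fun_eq_iff)
    have "runs (enc x) (compile \<phi>) ?s (f n)
        (?s(4 := of_bool (sem (cell (enc x) 0) n (\<lambda>j. ?s (var j)) \<phi>)))"
      using f n r unfolding decides_within_def by blast
    then have "runs (enc x) (compile \<phi>) ?s (f n) (?s(4 := of_bool (Q x)))"
      unfolding e Q .
    then have "runs (enc x) (read_size ;; compile \<phi>) (\<lambda>_. 0) (Suc (n * 8 + 10 + f n)) (?s(4 := of_bool (Q x)))"
      by (rule runs_Seq[OF runs_read_size[OF x]])
    moreover have "Suc (n * 8 + 10 + f n) \<le> poly (p + [:11, 8:]) (length (enc x))"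
      using p[of n] poly_mono_nat[OF n, of p] n by (simp add: algebra_simps)
    ultimately have "runs (enc x) (read_size ;; compile \<phi>) (\<lambda>_. 0) (poly (p + [:11, 8:]) (length (enc x)))
        (?s(4 := of_bool (Q x)))" by (rule runs_weaken) simp
    then show "\<exists>s. runs (enc x) (read_size ;; compile \<phi>) (\<lambda>_. 0) (poly (p + [:11, 8:]) (length (enc x))) s \<and>
        (s 4 \<noteq> 0 \<longleftrightarrow> Q x)" by (intro exI conjI) auto
  qed
qed

section \<open>The formula for conflict-free colorability\<close>

definition Disj :: "fm \<Rightarrow> fm \<Rightarrow> fm" where "Disj p q = Neg (Conj (Neg p) (Neg q))"
definition Forall :: "nat \<Rightarrow> fm \<Rightarrow> fm" where "Forall j p = Neg (Exists j (Neg p))"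
definition Equal :: "nat \<Rightarrow> nat \<Rightarrow> fm" where "Equal i j = Conj (Leq i j) (Leq j i)"

text \<open>The offset 2 accounts for the mark in cell 0 and the zero bit after the unary
  \<open>n\<close>; symbol 3 is the bit one.\<close>

definition Adj :: "bool \<Rightarrow> nat \<Rightarrow> nat \<Rightarrow> fm" where
  "Adj cl v u = (if cl then Disj (Sym 2 v u 3) (Equal v u) else Sym 2 v u 3)"

text \<open>\<open>red\<close> describes the red class through its variable 5; other variables in it
  act as parameters.\<close>

definition Two_Coloring :: "bool \<Rightarrow> fm \<Rightarrow> fm" where
  "Two_Coloring cl red = Forall 4 (Disj (Exists1 5 (Conj (Adj cl 4 5) red)) (Exists1 5 (Conj (Adj cl 4 5) (Neg red))))"

text \<open>Variable 0 has value \<open>n\<close> and the unbound variable 1 has value 0, so \<open>Sym c 0 1 b\<close> tests the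
  cell \<open>n\<^sup>2 + n + c\<close>: for \<open>c = 2\<close> the sign of \<open>k\<close> and for \<open>c = 3, 4, 5\<close> its three lowest bits.\<close>

definition Colorable :: "bool \<Rightarrow> fm" where
  "Colorable cl = Conj (Sym 2 0 1 2)
     (Disj (Conj (Neg (Sym 3 0 1 0)) (Forall 4 (Exists1 5 (Adj cl 4 5))))
     (Disj (Conj (Neg (Sym 4 0 1 0)) (Exists 2 (Exists 3
         (Disj (Two_Coloring cl (Disj (Equal 5 2) (Equal 5 3)))
               (Two_Coloring cl (Conj (Adj cl 2 5) (Neg (Equal 5 3))))))))
       (Conj (Conj (Neg (Sym 4 0 1 0)) (Disj (Sym 3 0 1 3) (Neg (Sym 5 0 1 0)))) (Forall 4 (Exists 5 (Adj cl 4 5))))))"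

lemma sem_derived [simp]:
  "sem a n e (Disj p q) \<longleftrightarrow> sem a n e p \<or> sem a n e q"
  "sem a n e (Forall j p) \<longleftrightarrow> (\<forall>x<n. sem a n (e(j := x)) p)"
  "sem a n e (Equal i j) \<longleftrightarrow> e i = e j"
  by (auto simp: Disj_def Forall_def Equal_def)

lemma Colorable_scoping: "rebinding_free (Colorable cl)" "0 \<notin> bound_vars (Colorable cl)"
  by (simp_all add: Colorable_def Two_Coloring_def Adj_def Disj_def Forall_def Equal_def)

section \<open>The encoded instance as seen by the formula\<close>

lemma length_matrix: "length (concat (map (\<lambda>i. map (f i) [0..<n]) [0..<r])) = r * n"
  by (induction r) auto

lemma nth_matrix:
  "\<lbrakk>i < r; j < n\<rbrakk> \<Longrightarrow> concat (map (\<lambda>i. map (f i) [0..<n]) [0..<r]) ! (i * n + j) = f i j"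
proof (induction r)
  case (Suc r)
  show ?case
  proof (cases "i < r")
    case True
    then have "Suc i * n \<le> r * n" by (intro mult_le_mono1) simp
    then have "i * n + j < r * n" using Suc.prems by simp
    then show ?thesis using Suc True by (simp add: nth_append length_matrix)
  next
    case False
    with Suc.prems have "i = r" by simp
    then show ?thesis using Suc.prems by (simp add: nth_append length_matrix)
  qed
qed simp

lemma nat_bits_facts:
  "nat_bits m = [] \<longleftrightarrow> m = 0"
  "m \<noteq> 0 \<Longrightarrow> nat_bits m ! 0 \<longleftrightarrow> odd m"
  "1 < length (nat_bits m) \<longleftrightarrow> 2 \<le> m"
  "2 < length (nat_bits m) \<longleftrightarrow> 4 \<le> m"
proof -
  have Nil: "nat_bits m = [] \<longleftrightarrow> m = 0" for m by (subst nat_bits.simps) simp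
  have len: "length (nat_bits m) = (if m = 0 then 0 else Suc (length (nat_bits (m div 2))))" for m
    by (subst nat_bits.simps) simp
  have len2: "1 < length (nat_bits m) \<longleftrightarrow> 2 \<le> m" for m
  proof -
    have "1 < length (nat_bits m) \<longleftrightarrow> m \<noteq> 0 \<and> m div 2 \<noteq> 0"
      unfolding len[of m] using Nil[of "m div 2"] by simp
    then show ?thesis by linarith
  qed
  show "nat_bits m = [] \<longleftrightarrow> m = 0" by (rule Nil)
  show "m \<noteq> 0 \<Longrightarrow> nat_bits m ! 0 \<longleftrightarrow> odd m" by (subst nat_bits.simps) simp
  show "1 < length (nat_bits m) \<longleftrightarrow> 2 \<le> m" by (rule len2)
  show "2 < length (nat_bits m) \<longleftrightarrow> 4 \<le> m"
  proof -
    have "2 < length (nat_bits m) \<longleftrightarrow> m \<noteq> 0 \<and> 2 \<le> m div 2"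
      unfolding len[of m] using len2[of "m div 2"] by simp
    then show ?thesis by linarith
  qed
qed

context
  fixes G :: "nat pair_pre_digraph" and k :: int and n :: nat and xs :: "bool list"
  assumes V: "pverts G = {..<n}"
  defines "xs \<equiv> encode_instance (G, k)"
begin

lemma xs_eq:
  "xs = replicate n True @ False # concat (map (\<lambda>i. map (\<lambda>j. (i, j) \<in> parcs G) [0..<n]) [0..<n]) @
     (k < 0) # nat_bits (nat \<bar>k\<bar>)"
  by (simp add: xs_def V)

lemma cell_Suc: "cell xs 0 (Suc m) = (if m < length xs then bit_symbol (xs ! m) else 0)"
  by (simp add: cell_def init_tape_def Suc_le_eq)

lemma cell_matrix:
  assumes "v < n" "u < n"
  shows "cell xs 0 (2 + n + v * n + u) = 3 \<longleftrightarrow> (v, u) \<in> parcs G"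
proof -
  have "Suc v * n \<le> n * n" using assms by (intro mult_le_mono1) simp
  then have "v * n + u < n * n" using assms by simp
  moreover have "cell xs 0 (2 + n + v * n + u) = cell xs 0 (Suc (n + Suc (v * n + u)))" by (simp add: add.assoc)
  ultimately show ?thesis
    unfolding cell_Suc using nth_matrix[OF assms, of "\<lambda>i j. (i, j) \<in> parcs G"]
    by (simp add: xs_eq nth_append length_matrix bit_symbol_def)
qed

text \<open>Index 0 is the sign and \<open>i \<ge> 1\<close> the binary digit \<open>i - 1\<close>.
  Behind the input the tape is blank, so symbol 0 reveals where the number ends.\<close>

lemma cell_number:
  "cell xs 0 (2 + i + n + n * n) =
     (if i \<le> length (nat_bits (nat \<bar>k\<bar>)) then bit_symbol (((k < 0) # nat_bits (nat \<bar>k\<bar>)) ! i) else 0)"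
proof -
  have "cell xs 0 (2 + i + n + n * n) = cell xs 0 (Suc (n + Suc (n * n + i)))" by (simp add: algebra_simps)
  then show ?thesis
    unfolding cell_Suc by (simp add: xs_eq nth_append length_matrix)
qed

text \<open>The binary representation has no leading zeros, so non-blank cells measure its length:
  one digit means \<open>1 \<le> k\<close>, two mean \<open>2 \<le> k\<close>, three mean
  \<open>4 \<le> k\<close>. To get \<open>3 \<le> k\<close>, only 2 has to be excluded among numbers
  with two digits, and the lowest digit does that.\<close>

lemma number_tests:
  "cell xs 0 (2 + n + n * n) = 2 \<longleftrightarrow> 0 \<le> k"
  "0 \<le> k \<Longrightarrow> cell xs 0 (3 + n + n * n) \<noteq> 0 \<longleftrightarrow> 1 \<le> k"
  "0 \<le> k \<Longrightarrow> cell xs 0 (4 + n + n * n) \<noteq> 0 \<longleftrightarrow> 2 \<le> k"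
  "0 \<le> k \<Longrightarrow> cell xs 0 (4 + n + n * n) \<noteq> 0 \<and> (cell xs 0 (3 + n + n * n) = 3 \<or> cell xs 0 (5 + n + n * n) \<noteq> 0) \<longleftrightarrow> 3 \<le> k"
proof -
  let ?m = "nat \<bar>k\<bar>"
  note f = nat_bits_facts[of ?m]
  show "cell xs 0 (2 + n + n * n) = 2 \<longleftrightarrow> 0 \<le> k"
    using cell_number[of 0] by (simp add: bit_symbol_def)
  assume k: "0 \<le> k"
  have nz: "bit_symbol b \<noteq> 0" for b by (simp add: bit_symbol_def)
  have 1: "cell xs 0 (3 + n + n * n) \<noteq> 0 \<longleftrightarrow> 1 \<le> length (nat_bits ?m)"
    using cell_number[of 1] nz by simp
  have 2: "cell xs 0 (4 + n + n * n) \<noteq> 0 \<longleftrightarrow> 2 \<le> length (nat_bits ?m)"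
    using cell_number[of 2] nz by simp
  have 3: "cell xs 0 (5 + n + n * n) \<noteq> 0 \<longleftrightarrow> 3 \<le> length (nat_bits ?m)"
    using cell_number[of 3] nz by simp
  have 4: "cell xs 0 (3 + n + n * n) = 3 \<longleftrightarrow> nat_bits ?m ! 0" if "1 \<le> length (nat_bits ?m)"
    using cell_number[of 1] that by (simp add: bit_symbol_def)
  have len1: "1 \<le> length (nat_bits ?m) \<longleftrightarrow> ?m \<noteq> 0" using f(1) by (cases "nat_bits ?m") auto
  have len: "2 \<le> length (nat_bits ?m) \<longleftrightarrow> 2 \<le> ?m" "3 \<le> length (nat_bits ?m) \<longleftrightarrow> 4 \<le> ?m"
    using f(3,4) by linarith+
  show "cell xs 0 (3 + n + n * n) \<noteq> 0 \<longleftrightarrow> 1 \<le> k" unfolding 1 len1 using k by linarith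
  show c2: "cell xs 0 (4 + n + n * n) \<noteq> 0 \<longleftrightarrow> 2 \<le> k" unfolding 2 len using k by linarith
  have odd: "odd ?m \<longleftrightarrow> odd k" using k by (simp add: even_nat_iff)
  show "cell xs 0 (4 + n + n * n) \<noteq> 0 \<and> (cell xs 0 (3 + n + n * n) = 3 \<or> cell xs 0 (5 + n + n * n) \<noteq> 0) \<longleftrightarrow> 3 \<le> k"
  proof (cases "2 \<le> k")
    case False
    then show ?thesis using c2 by simp
  next
    case True
    then have "?m \<noteq> 0" by simp
    then have "cell xs 0 (3 + n + n * n) = 3 \<longleftrightarrow> odd k" using 4 len1 f(2) odd by simp
    moreover have "cell xs 0 (5 + n + n * n) \<noteq> 0 \<longleftrightarrow> 4 \<le> k" unfolding 3 len using k by linarith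
    moreover have "odd k \<or> 4 \<le> k \<longleftrightarrow> 3 \<le> k" using True by presburger
    ultimately show ?thesis using True c2 by simp
  qed
qed

lemma sem_Adj:
  assumes "e v < n" "e u < n"
  shows "sem (cell xs 0) n e (Adj cl v u) \<longleftrightarrow> e u \<in> nbhd cl G (e v)"
proof -
  have "sem (cell xs 0) n e (Sym 2 v u 3) \<longleftrightarrow> (e v, e u) \<in> parcs G"
    using cell_matrix[OF assms] by (simp only: sem.simps)
  moreover have "e u \<in> nbhd cl G (e v) \<longleftrightarrow> (e v, e u) \<in> parcs G \<or> cl \<and> e v = e u"
    using assms by (simp add: nbhd_def closed_nbhd_def open_nbhd_def V disj_commute eq_commute[of "e u"])
  ultimately show ?thesis
    by (simp add: Adj_def del: sem.simps(1))
qed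

lemma sem_Two_Coloring:
  assumes red: "\<And>v u. v < n \<Longrightarrow> u < n \<Longrightarrow> sem (cell xs 0) n (e(4 := v, 5 := u)) red \<longleftrightarrow> u \<in> R"
  shows "sem (cell xs 0) n e (Two_Coloring cl red) \<longleftrightarrow> conflict_free {..<n} (nbhd cl G) R"
proof -
  have "{x. x < n \<and> sem (cell xs 0) n (e(4 := v, 5 := x)) (Conj (Adj cl 4 5) red)} = nbhd cl G v \<inter> R"
    "{x. x < n \<and> sem (cell xs 0) n (e(4 := v, 5 := x)) (Conj (Adj cl 4 5) (Neg red))} = nbhd cl G v - R"
    if "v < n" for v
  proof -
    \<comment> \<open>Hence the restriction of the quantifier to values below \<open>n\<close> loses
      no neighbor.\<close>
    have "nbhd cl G v \<subseteq> {..<n}"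
      using that V by (auto simp: nbhd_def closed_nbhd_def open_nbhd_def)
    then show "{x. x < n \<and> sem (cell xs 0) n (e(4 := v, 5 := x)) (Conj (Adj cl 4 5) red)} = nbhd cl G v \<inter> R"
      "{x. x < n \<and> sem (cell xs 0) n (e(4 := v, 5 := x)) (Conj (Adj cl 4 5) (Neg red))} = nbhd cl G v - R"
      using that red by (auto simp: sem_Adj)
  qed
  then show ?thesis
    by (simp add: Two_Coloring_def conflict_free_def Ball_def del: sem.simps(4))
qed

lemma sem_Colorable:
  assumes "cograph G" "connected G"
  shows "sem (cell xs 0) n ((\<lambda>_. 0)(0 := n)) (Colorable cl) \<longleftrightarrow> colorable (pverts G) (nbhd cl G) k"
proof -
  let ?e = "(\<lambda>_. 0)(0 := n) :: nat \<Rightarrow> nat" and ?N = "nbhd cl G"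
  have N: "?N v \<subseteq> {..<n}" if "v < n" for v
    using that V by (auto simp: nbhd_def closed_nbhd_def open_nbhd_def)
  have set: "{x. x < n \<and> sem (cell xs 0) n (?e(4 := v, 5 := x)) (Adj cl 4 5)} = ?N v" if "v < n" for v
    using that N[OF that] by (auto simp: sem_Adj)
  have one: "sem (cell xs 0) n ?e (Forall 4 (Exists1 5 (Adj cl 4 5))) \<longleftrightarrow> (\<forall>v\<in>pverts G. card (?N v) = 1)"
    using set by (simp add: V Ball_def)
  have three: "sem (cell xs 0) n ?e (Forall 4 (Exists 5 (Adj cl 4 5))) \<longleftrightarrow> (\<forall>v\<in>pverts G. ?N v \<noteq> {})"
    using set by (simp add: V Ball_def) blast
  have two: "sem (cell xs 0) n ?e (Exists 2 (Exists 3
         (Disj (Two_Coloring cl (Disj (Equal 5 2) (Equal 5 3)))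
               (Two_Coloring cl (Conj (Adj cl 2 5) (Neg (Equal 5 3))))))) \<longleftrightarrow>
      (\<exists>R. canonical_red (pverts G) ?N R \<and> conflict_free (pverts G) ?N R)"
  proof -
    have S: "sem (cell xs 0) n (?e(2 := x, 3 := y)) (Two_Coloring cl (Disj (Equal 5 2) (Equal 5 3))) \<longleftrightarrow>
          conflict_free {..<n} ?N {x, y}"
        "sem (cell xs 0) n (?e(2 := x, 3 := y)) (Two_Coloring cl (Conj (Adj cl 2 5) (Neg (Equal 5 3)))) \<longleftrightarrow>
          conflict_free {..<n} ?N (?N x - {y})" if "x < n" "y < n" for x y
      by (rule sem_Two_Coloring; use that in \<open>simp add: sem_Adj\<close>)+
    let ?P = "conflict_free {..<n} ?N"
    have "(\<exists>x<n. \<exists>y<n. ?P {x, y} \<or> ?P (?N x - {y})) \<longleftrightarrow> (\<exists>R. canonical_red {..<n} ?N R \<and> ?P R)"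
    proof
      assume "\<exists>x<n. \<exists>y<n. ?P {x, y} \<or> ?P (?N x - {y})"
      then obtain x y where xy: "x \<in> {..<n}" "y \<in> {..<n}" "?P {x, y} \<or> ?P (?N x - {y})" by auto
      then have "canonical_red {..<n} ?N {x, y}" "canonical_red {..<n} ?N (?N x - {y})"
        unfolding canonical_red_def by blast+
      with xy(3) show "\<exists>R. canonical_red {..<n} ?N R \<and> ?P R" by blast
    next
      assume "\<exists>R. canonical_red {..<n} ?N R \<and> ?P R"
      then obtain R x y where "x < n" "y < n" "R = {x, y} \<or> R = ?N x - {y}" "?P R"
        unfolding canonical_red_def by (elim exE conjE bexE) (simp only: lessThan_iff)
      then show "\<exists>x<n. \<exists>y<n. ?P {x, y} \<or> ?P (?N x - {y})" by metis
    qed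
    then show ?thesis
      unfolding V by (simp only: sem.simps(5) sem_derived S cong: conj_cong)
  qed
  have num: "sem (cell xs 0) n ?e (Sym c 0 1 b) \<longleftrightarrow> cell xs 0 (c + n + n * n) = b" for c b by simp
  \<comment> \<open>With the three graph conditions abstracted to \<open>p\<close>, \<open>q\<close>
    and \<open>r\<close>, only the tests on \<open>k\<close> remain. For negative \<open>k\<close>
    the sign test fails, as do all three comparisons.\<close>
  have "cell xs 0 (2 + n + n * n) = 2 \<and> (cell xs 0 (3 + n + n * n) \<noteq> 0 \<and> p \<or>
      cell xs 0 (4 + n + n * n) \<noteq> 0 \<and> q \<or>
      (cell xs 0 (4 + n + n * n) \<noteq> 0 \<and> (cell xs 0 (3 + n + n * n) = 3 \<or> cell xs 0 (5 + n + n * n) \<noteq> 0)) \<and> r) \<longleftrightarrow>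
      1 \<le> k \<and> p \<or> 2 \<le> k \<and> q \<or> 3 \<le> k \<and> r" for p q r
  proof (cases "0 \<le> k")
    case True
    show ?thesis
      using number_tests(1) number_tests(2-4)[OF True] True by blast
  next
    case False
    then show ?thesis using number_tests(1) by simp
  qed
  then show ?thesis
    unfolding colorable_iff[OF assms] Colorable_def sem_derived(1) sem.simps(3,4) one two three num .
qed

end

lemma poly_time_solvable_colorable:
  "poly_time_solvable cograph_instances encode_instance (\<lambda>(G, k). colorable (pverts G) (nbhd cl G) k)"
proof (rule poly_time_solvable_by_fm[OF Colorable_scoping])
  fix x assume "x \<in> cograph_instances"
  then obtain G k n where x: "x = (G, k)" and G: "cograph G" "connected G" "pverts G = {..<n}"
    by (auto simp: cograph_instances_def)
  show "\<exists>n ys. encode_instance x = replicate n True @ False # ys \<and>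
      (sem (cell (encode_instance x) 0) n ((\<lambda>_. 0)(0 := n)) (Colorable cl) \<longleftrightarrow>
       (case x of (G, k) \<Rightarrow> colorable (pverts G) (nbhd cl G) k))"
    using sem_Colorable[OF G(3,1,2)] xs_eq[OF G(3)] unfolding x by auto
qed

theorem theorem7:
  shows "poly_time_solvable cograph_instances encode_instance
           (\<lambda>(G, k). \<exists>C. CF_CN_coloring G k C) \<and>
         poly_time_solvable cograph_instances encode_instance
           (\<lambda>(G, k). \<exists>C. CF_ON_coloring G k C)"
proof
  show "poly_time_solvable cograph_instances encode_instance (\<lambda>(G, k). \<exists>C. CF_CN_coloring G k C)"
    using poly_time_solvable_colorable[of True]
    by (simp add: colorable_def CF_CN_coloring_def nbhd_def)
  show "poly_time_solvable cograph_instances encode_instance (\<lambda>(G, k). \<exists>C. CF_ON_coloring G k C)"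
    using poly_time_solvable_colorable[of False]
    by (simp add: colorable_def CF_ON_coloring_def nbhd_def)
qed

end
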